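(* Let $g(\alpha)$ be a differentiable function. The equation $$u_{t}+\frac{1}{2}\,\frac{\sigma^{2}S^{2}u_{SS}}{\left(1-\rho\,\frac{g'(\rho u_{S})}{g(\rho u_{S})}\,S\,u_{SS}\right)^{2}}=0$$ for $u=u(S,t)$ admits a four-dimensional Lie algebra if and only if the function $g(\alpha)$ has one of the following forms: $$g(\alpha)=c_2e^{c_1\alpha},\qquad g(\alpha)=c_2\,\alpha^{c_1},\qquad g(\alpha)=c_2(\rho+k\alpha)^{-\frac{1}{c_1}},$$ where $c_1,c_2,k$ are non-zero real constants.
   Context: The independent variables are $S,t$ and the dependent variable is $u$; $\sigma^2,\rho\in\mathbb{R}^+$ are parameters. Let $M$ be the space of points $(S,t,u)$ and $M^{(2)}$ the second jet bundle with coordinates $(S,t,u,u_S,u_t,u_{SS},u_{St},u_{tt})$. Write the PDE as $\Delta=0$, with $\Delta$ a smooth map from $M^{(2)}$ to $\mathbb{R}$. For $V=\xi(S,t,u)\partial_S+\tau(S,t,u)\partial_t+\varphi(S,t,u)\partial_u$ let $pr^{(2)}V$ be its second prolongation to $M^{(2)}$. The determining equations are $pr^{(2)}V(\Delta)=0$ modulo $\Delta=0$. Their solutions give all infinitesimal generators admitted by the equation; the set of these generators forms a Lie algebra, called the Lie algebra admitted by the PDE (its symmetry algebra). *)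

theory Defs
  imports "HOL-Analysis.Analysis" "HOL-Library.Function_Algebras"
begin

text \<open>Pointwise real vector space structure on functions (hence on vector fields), so that
  the library's \<^term>\<open>subspace\<close> and \<^term>\<open>dim\<close> apply to sets of vector fields. By the definition of
  \<^term>\<open>dim\<close>, an infinite-dimensional subspace gets the value 0, so \<open>dim L = 4\<close> means exactly that
  \<open>L\<close> has a basis of four elements.\<close>

instantiation "fun" :: (type, real_vector) real_vector
begin

definition scaleR_fun :: "real \<Rightarrow> ('a \<Rightarrow> 'b) \<Rightarrow> 'a \<Rightarrow> 'b" where
  "scaleR_fun c f = (\<lambda>x. c *\<^sub>R f x)"

instance
  by standard (auto simp: scaleR_fun_def fun_eq_iff scaleR_add_right scaleR_add_left)

end

text \<open>Smoothness on an open set; \<^term>\<open>frechet_derivative f (at x) v\<close> is the derivative of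
  \<open>f\<close> at \<open>x\<close> in direction \<open>v\<close>.\<close>

primrec Ck_on ::
  "nat \<Rightarrow> 'a set \<Rightarrow> ('a::euclidean_space \<Rightarrow> 'b::euclidean_space) \<Rightarrow> bool" where
  "Ck_on 0 U f \<longleftrightarrow> continuous_on U f"
| "Ck_on (Suc k) U f \<longleftrightarrow>
     (\<forall>x\<in>U. f differentiable at x) \<and> (\<forall>v. Ck_on k U (\<lambda>x. frechet_derivative f (at x) v))"

definition smooth_on :: "'a set \<Rightarrow> ('a::euclidean_space \<Rightarrow> 'b::euclidean_space) \<Rightarrow> bool" where
  "smooth_on U f \<longleftrightarrow> open U \<and> (\<forall>k. Ck_on k U f)"

text \<open>Coordinates \<open>(S, t, u)\<close>, \<open>(S, t, u, u\<^sub>S, u\<^sub>t)\<close> and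
  \<open>(S, t, u, u\<^sub>S, u\<^sub>t, u\<^sub>S\<^sub>S, u\<^sub>S\<^sub>t, u\<^sub>t\<^sub>t)\<close>.\<close>

type_synonym jet0 = "real \<times> real \<times> real"
type_synonym jet1 = "real \<times> real \<times> real \<times> real \<times> real"
type_synonym jet2 = "real \<times> real \<times> real \<times> real \<times> real \<times> real \<times> real \<times> real"

text \<open>A vector field \<open>\<xi> \<partial>\<^sub>S + \<tau> \<partial>\<^sub>t + \<phi> \<partial>\<^sub>u\<close> is its coefficient
  function \<open>(\<xi>, \<tau>, \<phi>)\<close>.\<close>

type_synonym vfield = "jet0 \<Rightarrow> jet0"

definition xi :: "vfield \<Rightarrow> jet0 \<Rightarrow> real" where "xi V z = fst (V z)"
definition tau :: "vfield \<Rightarrow> jet0 \<Rightarrow> real" where "tau V z = fst (snd (V z))"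
definition phi :: "vfield \<Rightarrow> jet0 \<Rightarrow> real" where "phi V z = snd (snd (V z))"

text \<open>Total derivatives of functions of order 0 and order 1, for instance
  \<open>D\<^sub>S f = f\<^sub>S + u\<^sub>S f\<^sub>u\<close> and
  \<open>D\<^sub>S f = f\<^sub>S + u\<^sub>S f\<^sub>u + u\<^sub>S\<^sub>S (\<partial>f/\<partial>u\<^sub>S) + u\<^sub>S\<^sub>t (\<partial>f/\<partial>u\<^sub>t)\<close>.\<close>

definition DS0 :: "(jet0 \<Rightarrow> real) \<Rightarrow> jet1 \<Rightarrow> real" where
  "DS0 f = (\<lambda>(S, t, u, uS, ut). frechet_derivative f (at (S, t, u)) (1, 0, uS))"

definition Dt0 :: "(jet0 \<Rightarrow> real) \<Rightarrow> jet1 \<Rightarrow> real" where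
  "Dt0 f = (\<lambda>(S, t, u, uS, ut). frechet_derivative f (at (S, t, u)) (0, 1, ut))"

definition DS1 :: "(jet1 \<Rightarrow> real) \<Rightarrow> jet2 \<Rightarrow> real" where
  "DS1 f = (\<lambda>(S, t, u, uS, ut, uSS, uSt, utt).
     frechet_derivative f (at (S, t, u, uS, ut)) (1, 0, uS, uSS, uSt))"

definition Dt1 :: "(jet1 \<Rightarrow> real) \<Rightarrow> jet2 \<Rightarrow> real" where
  "Dt1 f = (\<lambda>(S, t, u, uS, ut, uSS, uSt, utt).
     frechet_derivative f (at (S, t, u, uS, ut)) (0, 1, ut, uSt, utt))"

text \<open>Second prolongation, by the standard recursion
  \<open>\<phi>\<^sup>J\<^sup>k = D\<^sub>k \<phi>\<^sup>J - u\<^sub>J\<^sub>S D\<^sub>k \<xi> - u\<^sub>J\<^sub>t D\<^sub>k \<tau>\<close>.\<close>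

definition phiS :: "vfield \<Rightarrow> jet1 \<Rightarrow> real" where
  "phiS V = (\<lambda>(S, t, u, uS, ut). let j = (S, t, u, uS, ut) in
     DS0 (phi V) j - uS * DS0 (xi V) j - ut * DS0 (tau V) j)"

definition phit :: "vfield \<Rightarrow> jet1 \<Rightarrow> real" where
  "phit V = (\<lambda>(S, t, u, uS, ut). let j = (S, t, u, uS, ut) in
     Dt0 (phi V) j - uS * Dt0 (xi V) j - ut * Dt0 (tau V) j)"

definition prolong2 :: "vfield \<Rightarrow> jet2 \<Rightarrow> jet2" where
  "prolong2 V = (\<lambda>(S, t, u, uS, ut, uSS, uSt, utt).
     let z = (S, t, u); j = (S, t, u, uS, ut); J = (S, t, u, uS, ut, uSS, uSt, utt) in
       (xi V z, tau V z, phi V z, phiS V j, phit V j,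
        DS1 (phiS V) J - uSS * DS0 (xi V) j - uSt * DS0 (tau V) j,
        Dt1 (phiS V) J - uSS * Dt0 (xi V) j - uSt * Dt0 (tau V) j,
        Dt1 (phit V) J - uSt * Dt0 (xi V) j - utt * Dt0 (tau V) j))"

text \<open>\<open>prolong2 V (\<Delta>) = 0\<close> modulo \<open>\<Delta> = 0\<close>, where \<open>\<Delta>\<close> is defined on the part \<open>U\<close> of the jet
  bundle.\<close>

definition infinitesimal_generator :: "jet2 set \<Rightarrow> (jet2 \<Rightarrow> real) \<Rightarrow> vfield \<Rightarrow> bool" where
  "infinitesimal_generator U \<Delta> V \<longleftrightarrow> smooth_on UNIV V \<and>
     (\<forall>J\<in>U. \<Delta> J = 0 \<longrightarrow> frechet_derivative \<Delta> (at J) (prolong2 V J) = 0)"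

definition symmetry_algebra :: "jet2 set \<Rightarrow> (jet2 \<Rightarrow> real) \<Rightarrow> vfield set" where
  "symmetry_algebra U \<Delta> = {V. infinitesimal_generator U \<Delta> V}"

definition lie_bracket :: "vfield \<Rightarrow> vfield \<Rightarrow> vfield" where
  "lie_bracket V W =
     (\<lambda>z. frechet_derivative W (at z) (V z) - frechet_derivative V (at z) (W z))"

definition lie_algebra_of_vfields :: "vfield set \<Rightarrow> bool" where
  "lie_algebra_of_vfields L \<longleftrightarrow> subspace L \<and> (\<forall>V\<in>L. \<forall>W\<in>L. lie_bracket V W \<in> L)"

definition admits_lie_algebra_of_dim :: "jet2 set \<Rightarrow> (jet2 \<Rightarrow> real) \<Rightarrow> nat \<Rightarrow> bool" where
  "admits_lie_algebra_of_dim U \<Delta> n \<longleftrightarrow>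
     lie_algebra_of_vfields (symmetry_algebra U \<Delta>) \<and> dim (symmetry_algebra U \<Delta>) = n"

text \<open>The left-hand side of the equation, and the part of the jet bundle on which it is defined
  when \<open>g\<close> is given on the interval \<open>I\<close>: the argument of \<open>g\<close> lies in \<open>I\<close> and the denominator
  does not vanish.\<close>

definition pde_denominator :: "real \<Rightarrow> (real \<Rightarrow> real) \<Rightarrow> real \<Rightarrow> real \<Rightarrow> real \<Rightarrow> real" where
  "pde_denominator \<rho> g S uS uSS = 1 - \<rho> * (deriv g (\<rho> * uS) / g (\<rho> * uS)) * S * uSS"

definition pde :: "real \<Rightarrow> real \<Rightarrow> (real \<Rightarrow> real) \<Rightarrow> jet2 \<Rightarrow> real" where
  "pde \<sigma> \<rho> g = (\<lambda>(S, t, u, uS, ut, uSS, uSt, utt).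
     ut + 1 / 2 * (\<sigma>\<^sup>2 * S\<^sup>2 * uSS / (pde_denominator \<rho> g S uS uSS)\<^sup>2))"

definition pde_domain :: "real \<Rightarrow> (real \<Rightarrow> real) \<Rightarrow> real set \<Rightarrow> jet2 set" where
  "pde_domain \<rho> g I = {(S, t, u, uS, ut, uSS, uSt, utt).
     \<rho> * uS \<in> I \<and> pde_denominator \<rho> g S uS uSS \<noteq> 0}"

text \<open>Real power with arbitrary real exponent. A negative base is read as its absolute value:
  \<open>x\<^sup>c\<close> and \<open>\<bar>x\<bar>\<^sup>c\<close> differ there by a constant factor only, which is absorbed
  into \<open>c\<^sub>2\<close>, and for positive base this is the usual power.\<close>

definition real_power :: "real \<Rightarrow> real \<Rightarrow> real" where
  "real_power x c = \<bar>x\<bar> powr c"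

end

theory Submission
  imports Defs
begin

text \<open>Write \<open>h p = \<rho> g'(\<rho> p) / g(\<rho> p)\<close>, with \<open>p = u\<^sub>S\<close>. The coefficient of \<open>u\<^sub>S\<^sub>t\<close> in the determining equation
  gives \<open>\<tau>\<^sub>S = \<tau>\<^sub>u = 0\<close>; with \<open>x = S u\<^sub>S\<^sub>S\<close> what remains is, up to a power of the denominator \<open>1 - h p x\<close>,
  a cubic polynomial in \<open>x\<close>. Compare its coefficients, and then those of the powers of \<open>p\<close> where \<open>h p \<noteq> 0\<close>.
  Unless \<open>h\<close> is identically 0 this leaves exactly the fields
  \<open>b S \<partial>\<^sub>S + c \<partial>\<^sub>t + (\<alpha> u + \<gamma> S + \<delta>) \<partial>\<^sub>u\<close> for which \<open>((\<alpha> - b) p + \<gamma>) h p\<close> does not depend on \<open>p\<close>. The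
  three parameters \<open>b = \<alpha>\<close>, \<open>c\<close>, \<open>\<delta>\<close> are always free, and a fourth one exists if and only if
  \<open>(m p + \<gamma>) h p = C\<close> with \<open>C \<noteq> 0\<close> for some \<open>m, \<gamma>\<close>; integrating \<open>h\<close> gives the three families for \<open>g\<close>. If \<open>h\<close> vanishes
  identically, all five parameters are free, so the dimension is not 4.\<close>

subsection \<open>Partial derivatives and the second prolongation\<close>

lemma Ck_on_linear_image:
  assumes "bounded_linear l"
  shows "Ck_on k UNIV f \<Longrightarrow> Ck_on k UNIV (\<lambda>x. l (f x))"
proof (induction k arbitrary: f)
  case 0
  then show ?case using assms
    by (simp add: bounded_linear.continuous_on)
next
  case (Suc k)
  have d: "((\<lambda>x. l (f x)) has_derivative (\<lambda>v. l (frechet_derivative f (at x) v))) (at x)" for x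
    using Suc.prems by (intro bounded_linear.has_derivative[OF assms]) (simp add: frechet_derivative_works)
  have "frechet_derivative (\<lambda>x. l (f x)) (at x) = (\<lambda>v. l (frechet_derivative f (at x) v))" for x
    using frechet_derivative_at[OF d] by simp
  then show ?case
    using Suc d by (auto simp: differentiable_def)
qed

lemma Ck_on_const: "Ck_on k UNIV (\<lambda>x. c)"
  by (induction k arbitrary: c) auto

lemma Ck_on_affine:
  assumes "bounded_linear l"
  shows "Ck_on k UNIV (\<lambda>x. l x + c)"
proof (cases k)
  case 0
  then show ?thesis using assms by (auto intro!: continuous_intros simp: linear_continuous_on)
next
  case (Suc j)
  have d: "((\<lambda>x. l x + c) has_derivative l) (at x)" for x
    by (intro has_derivative_add_const bounded_linear_imp_has_derivative assms)
  have "frechet_derivative (\<lambda>x. l x + c) (at x) = l" for x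
    using frechet_derivative_at[OF d] by simp
  then show ?thesis using Suc d by (auto simp: differentiable_def Ck_on_const)
qed

section \<open>Partial derivatives of smooth functions of \<open>(S, t, u)\<close>\<close>

definition pS :: "(jet0 \<Rightarrow> real) \<Rightarrow> jet0 \<Rightarrow> real" where
  "pS f z = frechet_derivative f (at z) (1, 0, 0)"
definition pt :: "(jet0 \<Rightarrow> real) \<Rightarrow> jet0 \<Rightarrow> real" where
  "pt f z = frechet_derivative f (at z) (0, 1, 0)"
definition pu :: "(jet0 \<Rightarrow> real) \<Rightarrow> jet0 \<Rightarrow> real" where
  "pu f z = frechet_derivative f (at z) (0, 0, 1)"

lemma smooth_on_partials:
  assumes "smooth_on UNIV f"
  shows "smooth_on UNIV (pS f)" "smooth_on UNIV (pt f)" "smooth_on UNIV (pu f)"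
proof -
  have "Ck_on k UNIV (\<lambda>z. frechet_derivative f (at z) v)" for k v
    using assms Ck_on.simps(2)[of k UNIV f] unfolding smooth_on_def by metis
  then show "smooth_on UNIV (pS f)" "smooth_on UNIV (pt f)" "smooth_on UNIV (pu f)"
    by (auto simp: smooth_on_def pS_def[abs_def] pt_def[abs_def] pu_def[abs_def])
qed

lemma smooth_on_continuous: "smooth_on UNIV f \<Longrightarrow> continuous_on UNIV f"
  unfolding smooth_on_def by (metis Ck_on.simps(1))

text \<open>Differentiability is the first step of the \<open>Ck_on\<close> recursion; linearity of
  the derivative then splits a direction into coordinate directions.\<close>

lemma smooth_on_has_derivative:
  assumes "smooth_on UNIV f"
  shows "(f has_derivative (\<lambda>(a, b, c). a * pS f z + b * pt f z + c * pu f z)) (at z)"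
proof -
  have "f differentiable at z"
    using assms Ck_on.simps(2)[of 0 UNIV f] unfolding smooth_on_def by (metis UNIV_I)
  then have d: "(f has_derivative frechet_derivative f (at z)) (at z)"
    by (simp add: frechet_derivative_works)
  have "frechet_derivative f (at z) (a, b, c) = a * pS f z + b * pt f z + c * pu f z" for a b c
  proof -
    have lin: "linear (frechet_derivative f (at z))" using d by (rule has_derivative_linear)
    have "frechet_derivative f (at z) (a, b, c) = frechet_derivative f (at z)
        (a *\<^sub>R (1, 0, 0) + b *\<^sub>R (0, 1, 0) + c *\<^sub>R (0, 0, 1))" by simp
    also have "\<dots> = a *\<^sub>R pS f z + b *\<^sub>R pt f z + c *\<^sub>R pu f z"
      unfolding pS_def pt_def pu_def by (simp only: linear_add[OF lin] linear_scale[OF lin])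
    finally show ?thesis by simp
  qed
  then have "frechet_derivative f (at z) = (\<lambda>(a, b, c). a * pS f z + b * pt f z + c * pu f z)"
    by (simp add: fun_eq_iff split_paired_all)
  then show ?thesis using d by (simp only:)
qed

lemma frechet_smooth:
  "smooth_on UNIV f \<Longrightarrow> frechet_derivative f (at z) = (\<lambda>(a, b, c). a * pS f z + b * pt f z + c * pu f z)"
  using frechet_derivative_at[OF smooth_on_has_derivative] by metis

section \<open>Explicit coefficients of the second prolongation\<close>

definition base :: "jet1 \<Rightarrow> jet0" where
  "base j = (fst j, fst (snd j), fst (snd (snd j)))"

text \<open>Pulls a coefficient function back to the first jets, so that \<open>phiS\<close>, which
  also involves \<open>uS\<close> and \<open>ut\<close>, can be differentiated by the usual
  rules.\<close>

lemma has_derivative_base: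
  assumes "smooth_on UNIV f"
  shows "((\<lambda>j. f (base j)) has_derivative (\<lambda>d. fst d * pS f (base j) + fst (snd d) * pt f (base j)
     + fst (snd (snd d)) * pu f (base j))) (at j)"
proof -
  have "(base has_derivative base) (at j)"
    unfolding base_def by (auto intro!: derivative_eq_intros)
  from has_derivative_compose[OF this smooth_on_has_derivative[OF assms]]
  show ?thesis by (simp add: base_def[of "_::jet1"] )
qed

lemma phiS_explicit:
  assumes "smooth_on UNIV (xi V)" "smooth_on UNIV (tau V)" "smooth_on UNIV (phi V)"
  shows "phiS V = (\<lambda>j. pS (phi V) (base j) + fst (snd (snd (snd j))) * pu (phi V) (base j)
    - fst (snd (snd (snd j))) * (pS (xi V) (base j) + fst (snd (snd (snd j))) * pu (xi V) (base j))
    - snd (snd (snd (snd j))) * (pS (tau V) (base j) + fst (snd (snd (snd j))) * pu (tau V) (base j)))"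
  by (auto simp: phiS_def fun_eq_iff DS0_def Let_def frechet_smooth assms base_def)

lemma phit_explicit:
  assumes "smooth_on UNIV (xi V)" "smooth_on UNIV (tau V)" "smooth_on UNIV (phi V)"
  shows "phit V (S, t, u, p, q) = pt (phi V) (S, t, u) + q * pu (phi V) (S, t, u)
    - p * (pt (xi V) (S, t, u) + q * pu (xi V) (S, t, u))
    - q * (pt (tau V) (S, t, u) + q * pu (tau V) (S, t, u))"
  by (auto simp: phit_def Dt0_def Let_def frechet_smooth assms)

text \<open>The chain rule produces the mixed second partials in both orders; they are kept apart
  and enter only through their sum.\<close>

lemma DS1_phiS_explicit:
  assumes "smooth_on UNIV (xi V)" "smooth_on UNIV (tau V)" "smooth_on UNIV (phi V)"
  shows "DS1 (phiS V) (S, t, u, p, q, r, s, w) = (let z = (S, t, u) in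
     pS (pS (phi V)) z + p * (pu (pS (phi V)) z + pS (pu (phi V)) z) + p^2 * pu (pu (phi V)) z
     + r * pu (phi V) z
     - p * (pS (pS (xi V)) z + p * (pu (pS (xi V)) z + pS (pu (xi V)) z) + p^2 * pu (pu (xi V)) z
     + r * pu (xi V) z) - r * (pS (xi V) z + p * pu (xi V) z)
     - q * (pS (pS (tau V)) z + p * (pu (pS (tau V)) z + pS (pu (tau V)) z) + p^2 * pu (pu (tau V)) z
     + r * pu (tau V) z) - s * (pS (tau V) z + p * pu (tau V) z))"
proof -
  note sm = assms smooth_on_partials[OF assms(1)] smooth_on_partials[OF assms(2)]
    smooth_on_partials[OF assms(3)]
  \<comment> \<open>The selected facts are the partials in \<open>S\<close> and \<open>u\<close> of
    \<xi>, \<tau> and \<phi>, the ones that occur in \<open>phiS\<close>.\<close>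
  note dd = sm(4,6,7,9,10,12)[THEN has_derivative_base]
  show ?thesis
    unfolding DS1_def split phiS_explicit[OF assms]
    by (subst frechet_derivative_at[symmetric],
        (rule derivative_eq_intros dd refl)+)
      (simp add: base_def Let_def algebra_simps power2_eq_square)
qed

subsection \<open>The equation on the jet bundle\<close>

text \<open>The nonlinear term of the equation as a function of \<open>uSS\<close>, where
  \<open>b\<close> stands for \<open>h uS * S\<close>. One factor \<open>1 - b * r\<close> cancels
  in the quotient rule, which leaves the cube.\<close>

lemma DERIV_nonlinear_term:
  fixes b r k :: real
  assumes "1 - b * r \<noteq> 0"
  shows "((\<lambda>y. k * y / (1 - b * y)\<^sup>2) has_real_derivative
        k * (1 + b * r) / (1 - b * r) ^ 3) (at r)"
proof -
  have "((\<lambda>y. k * y / (1 - b * y)\<^sup>2) has_real_derivative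
        (k * (1-b*r)\<^sup>2 - k * r * (2 * (1-b*r) * (-b))) / ((1-b*r)\<^sup>2 * (1-b*r)\<^sup>2)) (at r)"
    using assms by (auto intro!: derivative_eq_intros)
  moreover have "(k * (1-b*r)\<^sup>2 - k * r * (2 * (1-b*r) * (-b))) / ((1-b*r)\<^sup>2 * (1-b*r)\<^sup>2) = k * (1 + b * r) / (1 - b * r) ^ 3"
  proof -
    define D where "D = 1 - b * r"
    have "b * r = 1 - D" by (simp add: D_def)
    have "D \<noteq> 0" using assms by (simp add: D_def)
    have "(k * D\<^sup>2 - k * r * (2 * D * (-b))) = k * D * (1 + b*r)" by (simp add: D_def power2_eq_square algebra_simps)
    then show ?thesis using \<open>D \<noteq> 0\<close> unfolding D_def[symmetric]
      by (simp add: power2_eq_square power3_eq_cube)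
  qed
  ultimately show ?thesis by simp
qed
text \<open>For \<open>F = k * r / D^2\<close> and its derivative \<open>F1\<close> in
  \<open>r\<close>, the quotient of \<open>r * F1 - F\<close> by \<open>r * F1 + F\<close> is
  \<open>b * r\<close>. This is how \<open>h\<close> is read off from the equation.\<close>

lemma nonlinear_term_recovers_coefficient:
  fixes k r b D :: real
  assumes "D \<noteq> 0" "b * r = 1 - D"
  shows "r * (k * (1 + b * r) / D ^ 3) + k * r / D\<^sup>2 = 2 * k * r / D ^ 3"
   "r * (k * (1 + b * r) / D ^ 3) - k * r / D\<^sup>2 = 2 * k * r * (b * r) / D ^ 3"
  using assms(1) unfolding assms(2) by (simp_all add: field_simps power2_eq_square power3_eq_cube)

text \<open>Numerator of the quotient rule over the cube of the denominator; the \<open>dS\<close>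
  terms that contain \<open>h\<close> cancel.\<close>

lemma numerator_identity:
  fixes S r h h' k dS dp dr :: real
  shows "k * (2 * S * r * dS + S\<^sup>2 * dr) * (1 - h * S * r)
      + 2 * (k * S\<^sup>2 * r) * (h' * dp * S * r + h * dS * r + h * S * dr)
    = 2 * k * S * r * dS + 2 * k * h' * S ^ 3 * r\<^sup>2 * dp + k * S\<^sup>2 * (1 + h * S * r) * dr"
  by (simp add: power2_eq_square power3_eq_cube algebra_simps)

locale feedback_pde =
  fixes \<sigma> \<rho> :: real and I :: "real set" and g :: "real \<Rightarrow> real"
  assumes sigma: "\<sigma>\<^sup>2 > 0" and rho: "\<rho> > 0"
    and interval: "open I" "is_interval I" "I \<noteq> {}"
    and g_diff: "g differentiable_on I"
    and g_nz: "\<And>\<alpha>. \<alpha> \<in> I \<Longrightarrow> g \<alpha> \<noteq> 0"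
    and smooth: "smooth_on (pde_domain \<rho> g I) (pde \<sigma> \<rho> g)"
begin

text \<open>The derivative of \<open>ln \<bar>g (\<rho> * p)\<bar>\<close> in \<open>p\<close>. The
  equation depends on \<open>g\<close> only through this function.\<close>

definition h :: "real \<Rightarrow> real" where
  "h p = \<rho> * (deriv g (\<rho> * p) / g (\<rho> * p))"

definition P :: "real set" where "P = {p. \<rho> * p \<in> I}"

abbreviation \<kappa> :: real where "\<kappa> \<equiv> \<sigma>\<^sup>2 / 2"

lemma kappa_pos: "\<kappa> > 0" using sigma by simp

lemma mem_domain:
  "(S, t, u, p, q, r, s, w) \<in> pde_domain \<rho> g I \<longleftrightarrow> p \<in> P \<and> 1 - h p * S * r \<noteq> 0"
  by (simp add: pde_domain_def pde_denominator_def h_def P_def)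

lemma pde_eq:
  "pde \<sigma> \<rho> g (S, t, u, p, q, r, s, w) = q + \<kappa> * S\<^sup>2 * r / (1 - h p * S * r)\<^sup>2"
  by (simp add: pde_def pde_denominator_def h_def)

lemma pde_eq':
  "pde \<sigma> \<rho> g = (\<lambda>J. fst (snd (snd (snd (snd J)))) + \<kappa> * (fst J)\<^sup>2 * fst (snd (snd (snd (snd (snd J))))) /
     (1 - h (fst (snd (snd (snd J)))) * fst J * fst (snd (snd (snd (snd (snd J))))))\<^sup>2)"
  by (auto simp: fun_eq_iff pde_eq)

lemma open_P: "open P"
proof -
  have "P = (\<lambda>p. \<rho> * p) -` I" by (auto simp: P_def)
  moreover have "open ((\<lambda>p. \<rho> * p) -` I)"
    by (rule open_vimage[OF interval(1)]) (intro continuous_intros)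
  ultimately show ?thesis by simp
qed

lemma P_interval:
  assumes "a \<in> P" "b \<in> P" "a \<le> x" "x \<le> b"
  shows "x \<in> P"
proof -
  have "\<rho> * a \<le> \<rho> * x" "\<rho> * x \<le> \<rho> * b" using assms rho by auto
  with assms(1,2) show ?thesis
    using interval(2)[unfolded is_interval_1, rule_format, of "\<rho> * a" "\<rho> * b" "\<rho> * x"]
    by (simp add: P_def)
qed

lemma connected_P: "connected P"
proof (rule is_interval_connected)
  show "is_interval P" unfolding is_interval_1 using P_interval by blast
qed

lemma nonempty_P: "P \<noteq> {}"
proof -
  obtain \<alpha> where "\<alpha> \<in> I" using interval(3) by blast
  then have "\<alpha> / \<rho> \<in> P" using rho by (simp add: P_def)
  then show ?thesis by blast
qed

text \<open>With \<open>F\<close> the equation restricted to \<open>S = 1\<close>, \<open>u\<^sub>t = 0\<close>, \<open>u\<^sub>S\<^sub>S = r\<close> and \<open>F1\<close> its derivative in \<open>u\<^sub>S\<^sub>S\<close>, the function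
  \<open>h = (r F1 - F) / (r (r F1 + F))\<close> inherits differentiability from \<open>F\<close> and \<open>F1\<close>; \<open>g\<close> itself is only assumed
  to be differentiable once.\<close>

lemma h_differentiable:
  assumes p0: "p0 \<in> P"
  shows "h differentiable (at p0)"
proof -
  \<comment> \<open>A nonzero value of \<open>uSS\<close> at which the denominator is nonzero for
    \<open>S = 1\<close>: the value 1 fails only if \<open>h p0 = 1\<close>, and then -1 gives the
    denominator 2.\<close>
  define r where "r = (if h p0 = 1 then - 1 else 1 :: real)"
  have r: "r \<noteq> 0" "1 - h p0 * r \<noteq> 0" by (auto simp: r_def)
  define c :: "real \<Rightarrow> jet2" where "c x = (1, 0, 0, x, 0, r, 0, 0)" for x
  define e :: jet2 where "e = (0, 0, 0, 0, 0, 1, 0, 0)"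
  define F where "F = pde \<sigma> \<rho> g"
  define F1 where "F1 J = frechet_derivative F (at J) e" for J
  define N where "N = {x. c x \<in> pde_domain \<rho> g I}"
  have opU: "open (pde_domain \<rho> g I)" using smooth by (simp add: smooth_on_def)
  have N_eq: "N = c -` pde_domain \<rho> g I" by (auto simp: N_def)
  have "continuous_on UNIV c" unfolding c_def by (intro continuous_intros)
  then have opN: "open N" unfolding N_eq using opU by (rule open_vimage[rotated])
  have p0N: "p0 \<in> N" using p0 r by (simp add: N_def c_def mem_domain)
  \<comment> \<open>Two orders of differentiability: one to form \<open>F1\<close>, one to
    differentiate \<open>F1\<close> itself.\<close>
  have C2: "Ck_on (Suc (Suc 0)) (pde_domain \<rho> g I) F"
    using smooth unfolding smooth_on_def F_def by blast
  have dF: "F differentiable at J" and dF1: "F1 differentiable at J" if "J \<in> pde_domain \<rho> g I" for J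
    using C2 that unfolding Ck_on.simps F1_def by blast+
  have dc: "c differentiable at x" for x
    unfolding c_def differentiable_def by (rule exI, (rule derivative_eq_intros refl)+)
  have comp: "(\<lambda>x. F (c x)) differentiable at p0" "(\<lambda>x. F1 (c x)) differentiable at p0"
    using differentiable_chain_at[OF dc, of F p0] differentiable_chain_at[OF dc, of F1 p0]
      dF[of "c p0"] dF1[of "c p0"] p0N by (auto simp: N_def o_def)
  have val: "F (c x) = \<kappa> * r / (1 - h x * r)\<^sup>2" for x
    by (simp add: F_def c_def pde_eq)
  \<comment> \<open>The derivative along a line in the direction \<open>uSS\<close> is computed by
    the chain rule and by the explicit formula; uniqueness identifies the results.\<close>
  have val1: "F1 (c x) = \<kappa> * (1 + h x * r) / (1 - h x * r) ^ 3" if x: "x \<in> N" for x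
  proof -
    have D: "1 - h x * r \<noteq> 0" using x by (simp add: N_def c_def mem_domain)
    define l :: "real \<Rightarrow> jet2" where "l y = (1, 0, 0, x, 0, y, 0, 0)" for y
    have "(l has_derivative (\<lambda>y. y *\<^sub>R e)) (at r)"
      unfolding l_def e_def by (rule derivative_eq_intros refl | simp)+
    moreover have "(F has_derivative frechet_derivative F (at (l r))) (at (l r))"
      using dF[of "l r"] x by (simp add: N_def c_def l_def frechet_derivative_works)
    ultimately have *: "((\<lambda>y. F (l y)) has_derivative (\<lambda>y. frechet_derivative F (at (l r)) (y *\<^sub>R e))) (at r)"
      by (rule has_derivative_compose)
    have "linear (frechet_derivative F (at (l r)))"
      using dF[of "l r"] x by (simp add: N_def c_def l_def linear_frechet_derivative)
    then have "(\<lambda>y. frechet_derivative F (at (l r)) (y *\<^sub>R e)) = (*) (F1 (c x))"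
      by (auto simp: F1_def c_def l_def linear_scale)
    then have A: "((\<lambda>y. F (l y)) has_real_derivative F1 (c x)) (at r)"
      using * by (simp add: has_field_derivative_def)
    have "((\<lambda>y. \<kappa> * y / (1 - h x * y)\<^sup>2) has_real_derivative
        \<kappa> * (1 + h x * r) / (1 - h x * r) ^ 3) (at r)"
      by (rule DERIV_nonlinear_term[OF D])
    moreover have "(\<lambda>y. F (l y)) = (\<lambda>y. \<kappa> * y / (1 - h x * y)\<^sup>2)"
      by (simp add: F_def l_def pde_eq)
    ultimately show ?thesis using A DERIV_unique by metis
  qed
  define H where "H x = (r * F1 (c x) - F (c x)) / (r * (r * F1 (c x) + F (c x)))" for x
  have plus: "r * F1 (c x) + F (c x) = 2 * \<kappa> * r / (1 - h x * r) ^ 3"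
    and minus: "r * F1 (c x) - F (c x) = 2 * \<kappa> * r * (h x * r) / (1 - h x * r) ^ 3" if "x \<in> N" for x
  proof -
    have "1 - h x * r \<noteq> 0" using that by (simp add: N_def c_def mem_domain)
    then show "r * F1 (c x) + F (c x) = 2 * \<kappa> * r / (1 - h x * r) ^ 3"
      "r * F1 (c x) - F (c x) = 2 * \<kappa> * r * (h x * r) / (1 - h x * r) ^ 3"
      unfolding val val1[OF that] by (intro nonlinear_term_recovers_coefficient; simp)+
  qed
  have Hh: "H x = h x" if "x \<in> N" for x
  proof -
    have "1 - h x * r \<noteq> 0" using that by (simp add: N_def c_def mem_domain)
    then show ?thesis unfolding H_def plus[OF that] minus[OF that] using r(1) kappa_pos
      by (simp add: divide_simps)
  qed
  have nz: "r * (r * F1 (c p0) + F (c p0)) \<noteq> 0"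
    unfolding plus[OF p0N] using r kappa_pos by simp
  have "H differentiable at p0"
    unfolding H_def using comp nz by (auto intro!: derivative_intros)
  then obtain H' where "(H has_derivative H') (at p0)" by (auto simp: differentiable_def)
  \<comment> \<open>\<open>H\<close> is known to agree with \<open>h\<close> on \<open>N\<close>
    only, but \<open>N\<close> is an open neighbourhood of \<open>p0\<close>.\<close>
  then have "(h has_derivative H') (at p0)"
    by (rule has_derivative_transform_within_open[OF _ opN p0N Hh])
  then show ?thesis by (auto simp: differentiable_def)
qed

lemma h_DERIV: "p \<in> P \<Longrightarrow> (h has_real_derivative deriv h p) (at p)"
  using h_differentiable by (simp add: DERIV_deriv_iff_real_differentiable)

lemma pde_frechet:
  assumes "p \<in> P" "1 - h p * S * r \<noteq> 0"
  shows "frechet_derivative (pde \<sigma> \<rho> g) (at (S, t, u, p, q, r, s, w)) (dS, dt, du, dp, dq, dr, ds, dw)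
    = dq + (2 * \<kappa> * S * r * dS + 2 * \<kappa> * deriv h p * S ^ 3 * r\<^sup>2 * dp
         + \<kappa> * S\<^sup>2 * (1 + h p * S * r) * dr) / (1 - h p * S * r) ^ 3"
proof -
  define D where "D = (\<lambda>J::jet2. 1 - h (fst (snd (snd (snd J)))) * fst J * fst (snd (snd (snd (snd (snd J))))))"
  define N where "N = (\<lambda>J::jet2. \<kappa> * (fst J)\<^sup>2 * fst (snd (snd (snd (snd (snd J))))))"
  define J where "J = (S, t, u, p, q, r, s, w)"
  have p: "fst (snd (snd (snd J))) \<in> P" using assms by (simp add: J_def)
  have nz: "D J \<noteq> 0" using assms by (simp add: D_def J_def)
  have dD: "(D has_derivative (\<lambda>(dS, dt, du, dp, dq, dr, ds, dw).
      - (deriv h p * dp * S * r + h p * dS * r + h p * S * dr))) (at J)"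
    unfolding D_def
    by (rule derivative_eq_intros DERIV_compose_FDERIV[where f = h and g = "\<lambda>J. fst (snd (snd (snd J)))" and x = J, OF h_DERIV[OF p]] refl)+
      (auto simp: fun_eq_iff J_def algebra_simps)
  have dN: "(N has_derivative (\<lambda>(dS, dt, du, dp, dq, dr, ds, dw).
      \<kappa> * (2 * S * r * dS + S\<^sup>2 * dr))) (at J)"
    unfolding N_def
    by (rule derivative_eq_intros refl)+
      (auto simp: fun_eq_iff J_def algebra_simps)
  have "pde \<sigma> \<rho> g = (\<lambda>J. fst (snd (snd (snd (snd J)))) + N J / (D J)\<^sup>2)"
    by (simp add: pde_eq' N_def D_def)
  moreover have "((\<lambda>J. fst (snd (snd (snd (snd J)))) + N J / (D J)\<^sup>2) has_derivative
      (\<lambda>(dS, dt, du, dp, dq, dr, ds, dw). dq + (\<kappa> * (2 * S * r * dS + S\<^sup>2 * dr) * D J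
        + 2 * N J * (deriv h p * dp * S * r + h p * dS * r + h p * S * dr)) / D J ^ 3)) (at J)"
    by (rule derivative_eq_intros dD dN refl | simp add: nz)+
      (use nz in \<open>auto simp: fun_eq_iff field_simps power2_eq_square power3_eq_cube\<close>)
  ultimately have "(pde \<sigma> \<rho> g has_derivative
      (\<lambda>(dS, dt, du, dp, dq, dr, ds, dw). dq + (\<kappa> * (2 * S * r * dS + S\<^sup>2 * dr) * D J
        + 2 * N J * (deriv h p * dp * S * r + h p * dS * r + h p * S * dr)) / D J ^ 3)) (at J)"
    by simp
  from frechet_derivative_at[OF this, symmetric]
  have "frechet_derivative (pde \<sigma> \<rho> g) (at J) (dS, dt, du, dp, dq, dr, ds, dw) =
      dq + (\<kappa> * (2 * S * r * dS + S\<^sup>2 * dr) * D J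
        + 2 * N J * (deriv h p * dp * S * r + h p * dS * r + h p * S * dr)) / D J ^ 3"
    by simp
  also have "\<kappa> * (2 * S * r * dS + S\<^sup>2 * dr) * D J
        + 2 * N J * (deriv h p * dp * S * r + h p * dS * r + h p * S * dr)
      = 2 * \<kappa> * S * r * dS + 2 * \<kappa> * deriv h p * S ^ 3 * r\<^sup>2 * dp
         + \<kappa> * S\<^sup>2 * (1 + h p * S * r) * dr"
    unfolding D_def N_def J_def fst_conv snd_conv by (rule numerator_identity)
  finally show ?thesis by (simp add: J_def D_def)
qed

end

subsection \<open>The determining equations\<close>

text \<open>A nonzero polynomial has finitely many roots. This serves all coefficient comparisons,
  in \<open>x = S * uSS\<close> and in \<open>p\<close>; lower degrees are padded with zero
  coefficients.\<close>

lemma cubic_zero: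
  fixes a b c d :: real
  assumes "infinite X" and "\<And>x. x \<in> X \<Longrightarrow> a + b * x + c * x\<^sup>2 + d * x ^ 3 = 0"
  shows "a = 0" "b = 0" "c = 0" "d = 0"
proof -
  have "X \<subseteq> {x. poly [:a, b, c, d:] x = 0}"
    using assms(2) by (auto simp: algebra_simps power2_eq_square power3_eq_cube)
  with assms(1) have "infinite {x. poly [:a, b, c, d:] x = 0}" using finite_subset by blast
  then have "[:a, b, c, d:] = 0" using poly_roots_finite by blast
  then show "a = 0" "b = 0" "c = 0" "d = 0" by (simp_all add: pCons_eq_0_iff)
qed

text \<open>Take the limit along lines parallel to the \<open>S\<close> axis. The determining
  equations carry factors \<open>S\<close>, so coefficients can be compared only off the plane
  \<open>S = 0\<close>.\<close>

lemma zero_off_plane_imp_zero: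
  fixes f :: "jet0 \<Rightarrow> real"
  assumes cont: "continuous_on UNIV f" and z: "\<And>S t u. S \<noteq> 0 \<Longrightarrow> f (S, t, u) = 0"
  shows "f (S, t, u) = 0"
proof (cases "S = 0")
  case True
  have "continuous_on UNIV (\<lambda>x. f (x, t, u))"
    by (rule continuous_on_compose2[OF cont]) (auto intro!: continuous_intros)
  then have "((\<lambda>x. f (x, t, u)) \<longlongrightarrow> f (0, t, u)) (at 0)"
    by (simp add: continuous_on_def)
  moreover have "((\<lambda>x. f (x, t, u)) \<longlongrightarrow> 0) (at 0)"
    by (rule Lim_transform_eventually[OF tendsto_const]) (auto simp: eventually_at z intro!: exI[of _ 1])
  ultimately show ?thesis using True tendsto_unique[OF trivial_limit_at] by blast
qed (use z in auto)

lemma partial_const [simp]: "pS (\<lambda>z. c) z = 0" "pt (\<lambda>z. c) z = 0" "pu (\<lambda>z. c) z = 0"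
  by (simp_all add: pS_def pt_def pu_def)

text \<open>Reduces partials to one-variable derivatives, so that constancy can be argued along
  coordinate lines.\<close>

lemma DERIV_partials:
  assumes "smooth_on UNIV f"
  shows "((\<lambda>x. f (x, t, u)) has_real_derivative pS f (S, t, u)) (at S)"
    and "((\<lambda>x. f (S, x, u)) has_real_derivative pt f (S, t, u)) (at t)"
    and "((\<lambda>x. f (S, t, x)) has_real_derivative pu f (S, t, u)) (at u)"
proof -
  have "((\<lambda>x. (x, t, u)) has_derivative (\<lambda>d. (d, 0, 0))) (at S)"
    "((\<lambda>x. (S, x, u)) has_derivative (\<lambda>d. (0, d, 0))) (at t)"
    "((\<lambda>x. (S, t, x)) has_derivative (\<lambda>d. (0, 0, d))) (at u)"
    by (rule derivative_eq_intros refl | simp)+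
  note this[THEN has_derivative_compose, OF smooth_on_has_derivative[OF assms]]
  note * = this[THEN has_derivative_eq_rhs]
  show "((\<lambda>x. f (x, t, u)) has_real_derivative pS f (S, t, u)) (at S)"
    unfolding has_field_derivative_def by (rule *) (simp add: fun_eq_iff)
  show "((\<lambda>x. f (S, x, u)) has_real_derivative pt f (S, t, u)) (at t)"
    unfolding has_field_derivative_def by (rule *) (simp add: fun_eq_iff)
  show "((\<lambda>x. f (S, t, x)) has_real_derivative pu f (S, t, u)) (at u)"
    unfolding has_field_derivative_def by (rule *) (simp add: fun_eq_iff)
qed

lemma DERIV_zero_imp_const:
  fixes f :: "real \<Rightarrow> real"
  assumes "\<And>x. (f has_real_derivative 0) (at x)"
  shows "f x = f 0"
  using DERIV_isconst_all assms by blast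

lemma affine_of_second_DERIV_zero:
  fixes f :: "real \<Rightarrow> real"
  assumes "\<And>x. (f has_real_derivative f' x) (at x)" "\<And>x. (f' has_real_derivative 0) (at x)"
  shows "f x = f 0 + f' 0 * x" "f' x = f' 0"
proof -
  show *: "f' x = f' 0" for x using DERIV_zero_imp_const[OF assms(2)] .
  have "((\<lambda>x. f x - f' 0 * x) has_real_derivative 0) (at x)" for x
    by (rule derivative_eq_intros assms(1) refl)+ (simp add: *[of x])
  from DERIV_zero_imp_const[OF this, of x] show "f x = f 0 + f' 0 * x" by simp
qed

lemma smooth_components:
  assumes "smooth_on UNIV V"
  shows "smooth_on UNIV (xi V)" "smooth_on UNIV (tau V)" "smooth_on UNIV (phi V)"
proof -
  have V: "Ck_on k UNIV V" for k using assms by (simp add: smooth_on_def)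
  have "Ck_on k UNIV (\<lambda>z. fst (V z))" "Ck_on k UNIV (\<lambda>z. fst (snd (V z)))"
    "Ck_on k UNIV (\<lambda>z. snd (snd (V z)))" for k
    using Ck_on_linear_image[OF bounded_linear_fst V]
      Ck_on_linear_image[OF bounded_linear_compose[OF bounded_linear_fst bounded_linear_snd] V]
      Ck_on_linear_image[OF bounded_linear_compose[OF bounded_linear_snd bounded_linear_snd] V]
    by simp_all
  then show "smooth_on UNIV (xi V)" "smooth_on UNIV (tau V)" "smooth_on UNIV (phi V)"
    by (simp_all add: smooth_on_def xi_def[abs_def] tau_def[abs_def] phi_def[abs_def])
qed

text \<open>Multiplication by \<open>D^3\<close>, with \<open>uSS = x / S\<close>. On the equation
  \<open>m + ut * n\<close> is the prolonged coefficient of \<open>ut\<close>, \<open>B\<close> that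
  of \<open>uS\<close>, \<open>A + uSS * E\<close> that of \<open>uSS\<close> at
  \<open>uSt = 0\<close>, and \<open>X\<close> is \<xi>.\<close>

lemma clear_denominators:
  fixes S D :: real
  assumes "S \<noteq> 0" "D \<noteq> 0"
    and "(m + - (k * S\<^sup>2 * (x / S) / D\<^sup>2) * n) + (2 * k * S * (x / S) * X + 2 * k * h' * S ^ 3 * (x / S)\<^sup>2 * B
      + k * S\<^sup>2 * (1 + h * S * (x / S)) * (A + (x / S) * E)) / D ^ 3 = 0"
  shows "m * D ^ 3 - k * S * x * D * n + 2 * k * x * X + 2 * k * h' * S * x\<^sup>2 * B
      + k * S\<^sup>2 * (1 + h * x) * A + k * S * (1 + h * x) * x * E = 0"
proof -
  have 1: "S * (x / S) = x" "S\<^sup>2 * (x / S) = S * x" "S ^ 3 * (x / S)\<^sup>2 = S * x\<^sup>2"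
    using assms(1) by (simp_all add: power2_eq_square power3_eq_cube)
  have 2: "(m + - (Q / D\<^sup>2) * n + N / D ^ 3) * D ^ 3 = m * D ^ 3 - Q * D * n + N" for Q N
    using assms(2) by (simp add: field_simps power2_eq_square power3_eq_cube)
  have "(m + - (k * (S\<^sup>2 * (x / S)) / D\<^sup>2) * n) + (2 * k * (S * (x / S)) * X + 2 * k * h' * (S ^ 3 * (x / S)\<^sup>2) * B
      + k * S\<^sup>2 * (1 + h * (S * (x / S))) * (A + (x / S) * E)) / D ^ 3 = 0" (is "?lhs = 0")
    using assms(3) by (simp only: mult.assoc)
  then have "0 = ?lhs * D ^ 3" by (simp only: mult_zero_left)
  also have "\<dots> = m * D ^ 3 - k * (S * x) * D * n + (2 * k * x * X + 2 * k * h' * (S * x\<^sup>2) * B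
      + k * S\<^sup>2 * (1 + h * x) * (A + (x / S) * E))"
    unfolding 1 by (rule 2)
  also have "k * S\<^sup>2 * (1 + h * x) * (A + (x / S) * E) = k * S\<^sup>2 * (1 + h * x) * A + k * S * (1 + h * x) * x * E"
    using assms(1) by (simp add: power2_eq_square field_simps)
  finally show ?thesis by (simp add: algebra_simps)
qed

context feedback_pde
begin

text \<open>The determining expression after \<open>u\<^sub>t\<close> has been eliminated by the equation. It does not involve
  \<open>u\<^sub>t\<^sub>t\<close>, which is set to 0.\<close>

definition gen_expr :: "vfield \<Rightarrow> real \<Rightarrow> real \<Rightarrow> real \<Rightarrow> real \<Rightarrow> real \<Rightarrow> real \<Rightarrow> real" where
  "gen_expr V S t u p r s = (let D = 1 - h p * S * r; j = (S, t, u, p, - (\<kappa> * S\<^sup>2 * r / D\<^sup>2)) in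
     phit V j + (2 * \<kappa> * S * r * xi V (S, t, u) + 2 * \<kappa> * deriv h p * S ^ 3 * r\<^sup>2 * phiS V j
       + \<kappa> * S\<^sup>2 * (1 + h p * S * r) *
         (DS1 (phiS V) (S, t, u, p, - (\<kappa> * S\<^sup>2 * r / D\<^sup>2), r, s, 0)
           - r * DS0 (xi V) j - s * DS0 (tau V) j)) / D ^ 3)"

text \<open>The equation has the form \<open>ut = ...\<close>, so its zero set is a graph over the
  other jet coordinates. The condition modulo the equation thus becomes an identity in those
  coordinates.\<close>

lemma generator_iff:
  "infinitesimal_generator (pde_domain \<rho> g I) (pde \<sigma> \<rho> g) V \<longleftrightarrow>
    smooth_on UNIV V \<and>
    (\<forall>S t u p r s. p \<in> P \<longrightarrow> 1 - h p * S * r \<noteq> 0 \<longrightarrow> gen_expr V S t u p r s = 0)"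
proof -
  have expr: "frechet_derivative (pde \<sigma> \<rho> g) (at (S, t, u, p, q, r, s, w))
      (prolong2 V (S, t, u, p, q, r, s, w)) = gen_expr V S t u p r s"
    if "p \<in> P" "1 - h p * S * r \<noteq> 0" "q = - (\<kappa> * S\<^sup>2 * r / (1 - h p * S * r)\<^sup>2)" for S t u p q r s w
    unfolding prolong2_def Let_def split pde_frechet[OF that(1,2)] gen_expr_def that(3)
    by (simp add: DS1_def)
  have root: "pde \<sigma> \<rho> g (S, t, u, p, q, r, s, w) = 0 \<longleftrightarrow> q = - (\<kappa> * S\<^sup>2 * r / (1 - h p * S * r)\<^sup>2)"
    for S t u p q r s w
    unfolding pde_eq by linarith
  have "(\<forall>J\<in>pde_domain \<rho> g I. pde \<sigma> \<rho> g J = 0 \<longrightarrow>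
      frechet_derivative (pde \<sigma> \<rho> g) (at J) (prolong2 V J) = 0) \<longleftrightarrow>
    (\<forall>S t u p r s. p \<in> P \<longrightarrow> 1 - h p * S * r \<noteq> 0 \<longrightarrow> gen_expr V S t u p r s = 0)" (is "?L \<longleftrightarrow> ?R")
  proof
    assume L: ?L
    show ?R
    proof (intro allI impI)
      fix S t u p r s assume p: "p \<in> P" "1 - h p * S * r \<noteq> 0"
      let ?J = "(S, t, u, p, - (\<kappa> * S\<^sup>2 * r / (1 - h p * S * r)\<^sup>2), r, s, 0) :: jet2"
      have "?J \<in> pde_domain \<rho> g I" unfolding mem_domain using p by blast
      moreover have "pde \<sigma> \<rho> g ?J = 0" unfolding root ..
      ultimately have "frechet_derivative (pde \<sigma> \<rho> g) (at ?J) (prolong2 V ?J) = 0"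
        by (rule L[rule_format])
      then show "gen_expr V S t u p r s = 0" unfolding expr[OF p refl] .
    qed
  next
    assume R: ?R
    show ?L
    proof (intro ballI impI)
      fix J assume J: "J \<in> pde_domain \<rho> g I" "pde \<sigma> \<rho> g J = 0"
      obtain S t u p q r s w where J_eq: "J = (S, t, u, p, q, r, s, w)" by (metis prod_cases3 surj_pair)
      have p: "p \<in> P" "1 - h p * S * r \<noteq> 0" using J(1) unfolding J_eq mem_domain by auto
      have q: "q = - (\<kappa> * S\<^sup>2 * r / (1 - h p * S * r)\<^sup>2)" using J(2) unfolding J_eq root .
      show "frechet_derivative (pde \<sigma> \<rho> g) (at J) (prolong2 V J) = 0"
        unfolding J_eq expr[OF p q] using R p by blast
    qed
  qed
  then show ?thesis by (simp add: infinitesimal_generator_def)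
qed

end

text \<open>At most the point \<open>1 / c\<close> has to be removed; for \<open>c = 0\<close> the
  convention \<open>1 / 0 = 0\<close> removes the harmless point 0.\<close>

lemma infinite_lin_nonzero: "infinite {x::real. 1 - c * x \<noteq> 0}"
proof (rule infinite_super)
  show "UNIV - {1 / c} \<subseteq> {x. 1 - c * x \<noteq> 0}" by (auto simp: eq_divide_eq mult.commute split: if_split_asm)
  show "infinite (UNIV - {1 / c})" by (simp add: infinite_UNIV_char_0)
qed

lemma partial_eq_0_if_const:
  assumes "\<And>z. f z = c" shows "pS f z = 0" "pt f z = 0" "pu f z = 0"
proof -
  have "f = (\<lambda>z. c)" using assms by auto
  then show "pS f z = 0" "pt f z = 0" "pu f z = 0" by simp_all
qed

text \<open>Expands the powers of the denominator, which gives the cubic in \<open>x\<close> that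
  \<open>cubic_zero\<close> expects.\<close>

lemma collect_powers:
  fixes m k S x h n X h' B A E :: real
  assumes "m * (1 - h * x) ^ 3 - k * S * x * (1 - h * x) * n + 2 * k * x * X + 2 * k * h' * S * x\<^sup>2 * B
      + k * S\<^sup>2 * (1 + h * x) * A + k * S * (1 + h * x) * x * E = 0"
  shows "(m + k * S\<^sup>2 * A) + (k * (2 * X + S * E - S * n) + h * (k * S\<^sup>2 * A - 3 * m)) * x
    + (k * S * (h * (n + E) + 2 * h' * B) + 3 * h\<^sup>2 * m) * x\<^sup>2 + (- (h ^ 3 * m)) * x ^ 3 = 0"
  unfolding assms[symmetric] by (simp add: power2_eq_square power3_eq_cube algebra_simps)

context feedback_pde
begin

definition affine_field :: "real \<Rightarrow> real \<Rightarrow> real \<Rightarrow> real \<Rightarrow> real \<Rightarrow> vfield" where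
  "affine_field b c \<alpha> \<gamma> \<delta> = (\<lambda>(S, t, u). (b * S, c, \<alpha> * u + \<gamma> * S + \<delta>))"

lemma infinite_P: "infinite P"
  using open_P nonempty_P finite_imp_not_open by blast

text \<open>By continuity of \<open>h\<close> the set is open, and a nonempty open set of reals is
  infinite. It supplies enough values of \<open>p\<close> to compare coefficients after division by
  \<open>h p\<close>.\<close>

lemma infinite_h_nonzero:
  assumes "p0 \<in> P" "h p0 \<noteq> 0"
  shows "infinite {p \<in> P. h p \<noteq> 0}"
proof -
  have "continuous_on P h"
    using h_DERIV DERIV_isCont continuous_at_imp_continuous_on by blast
  then have "open (P \<inter> h -` (- {0}))"
    using open_P by (intro continuous_open_preimage) auto
  moreover have "P \<inter> h -` (- {0}) = {p \<in> P. h p \<noteq> 0}" by auto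
  ultimately have "open {p \<in> P. h p \<noteq> 0}" by simp
  then show ?thesis using assms finite_imp_not_open by blast
qed

text \<open>\<open>uSt\<close> enters linearly, with a multiple of the total derivative
  \<open>\<tau>\<^sub>S + p * \<tau>\<^sub>u\<close> as coefficient. Subtracting the cases
  \<open>uSt = 1\<close> and \<open>uSt = 0\<close> at \<open>uSS = 0\<close>, where the denominator
  is 1, isolates it.\<close>

lemma generator_tau:
  assumes gen: "infinitesimal_generator (pde_domain \<rho> g I) (pde \<sigma> \<rho> g) V"
  shows "pS (tau V) z = 0" "pu (tau V) z = 0"
proof -
  from gen have sm: "smooth_on UNIV V"
    and ge: "\<And>S t u p r s. p \<in> P \<Longrightarrow> 1 - h p * S * r \<noteq> 0 \<Longrightarrow> gen_expr V S t u p r s = 0"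
    unfolding generator_iff by auto
  note c = smooth_components[OF sm]
  have S0: "pS (tau V) (S, t, u) = 0 \<and> pu (tau V) (S, t, u) = 0" if S: "S \<noteq> 0" for S t u
  proof -
    have "pS (tau V) (S, t, u) + pu (tau V) (S, t, u) * p + 0 * p\<^sup>2 + 0 * p ^ 3 = 0" if "p \<in> P" for p
    proof -
      have "gen_expr V S t u p 0 1 - gen_expr V S t u p 0 0
          = - (\<sigma>\<^sup>2 * S\<^sup>2 * (pS (tau V) (S, t, u) + p * pu (tau V) (S, t, u)))"
        by (simp add: gen_expr_def Let_def DS1_phiS_explicit[OF c] DS0_def frechet_smooth[OF c(2)] field_simps)
      then have "\<sigma>\<^sup>2 * S\<^sup>2 * (pS (tau V) (S, t, u) + p * pu (tau V) (S, t, u)) = 0"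
        using ge[OF that] by simp
      then have "pS (tau V) (S, t, u) + p * pu (tau V) (S, t, u) = 0" using S sigma by simp
      then show ?thesis by (simp add: mult.commute)
    qed
    from cubic_zero[OF infinite_P this] show ?thesis by blast
  qed
  obtain S t u where "z = (S, t, u)" by (cases z)
  then show "pS (tau V) z = 0" "pu (tau V) z = 0"
    using zero_off_plane_imp_zero[OF smooth_on_continuous[OF smooth_on_partials(1)[OF c(2)]]]
      zero_off_plane_imp_zero[OF smooth_on_continuous[OF smooth_on_partials(3)[OF c(2)]]] S0 by simp_all
qed

text \<open>Once \<tau> depends on \<open>t\<close> alone, the prolonged coefficients are affine in
  \<open>ut\<close> and \<open>uSS\<close> with coefficients polynomial in \<open>p\<close>. These
  are the four coefficients of the resulting cubic in \<open>x = S * uSS\<close>, taken at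
  \<open>uSt = 0\<close>.\<close>

lemma generator_reduced:
  assumes gen: "infinitesimal_generator (pde_domain \<rho> g I) (pde \<sigma> \<rho> g) V"
    and S: "S \<noteq> 0" and p: "p \<in> P" and z: "z = (S, t, u)"
  defines "m \<equiv> pt (phi V) z - p * pt (xi V) z"
    and "n \<equiv> pu (phi V) z - p * pu (xi V) z - pt (tau V) z"
    and "B \<equiv> pS (phi V) z + p * pu (phi V) z - p * pS (xi V) z - p\<^sup>2 * pu (xi V) z"
    and "A \<equiv> pS (pS (phi V)) z + (pu (pS (phi V)) z + pS (pu (phi V)) z - pS (pS (xi V)) z) * p
         + (pu (pu (phi V)) z - pu (pS (xi V)) z - pS (pu (xi V)) z) * p\<^sup>2 + (- pu (pu (xi V)) z) * p ^ 3"
    and "E \<equiv> pu (phi V) z - 2 * pS (xi V) z - 3 * p * pu (xi V) z"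
  shows "m + \<kappa> * S\<^sup>2 * A = 0"
    "\<kappa> * (2 * xi V z + S * E - S * n) + h p * (\<kappa> * S\<^sup>2 * A - 3 * m) = 0"
    "\<kappa> * S * (h p * (n + E) + 2 * deriv h p * B) + 3 * (h p)\<^sup>2 * m = 0"
    "h p ^ 3 * m = 0"
proof -
  from gen have sm: "smooth_on UNIV V"
    and ge: "\<And>S t u p r s. p \<in> P \<Longrightarrow> 1 - h p * S * r \<noteq> 0 \<Longrightarrow> gen_expr V S t u p r s = 0"
    unfolding generator_iff by auto
  note c = smooth_components[OF sm]
  note tau = generator_tau[OF gen]
  note tau2 = partial_eq_0_if_const[where f = "pS (tau V)", OF tau(1)]
    partial_eq_0_if_const[where f = "pu (tau V)", OF tau(2)]
  have "(m + \<kappa> * S\<^sup>2 * A) + (\<kappa> * (2 * xi V z + S * E - S * n) + h p * (\<kappa> * S\<^sup>2 * A - 3 * m)) * x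
    + (\<kappa> * S * (h p * (n + E) + 2 * deriv h p * B) + 3 * (h p)\<^sup>2 * m) * x\<^sup>2 + (- (h p ^ 3 * m)) * x ^ 3 = 0"
    if "x \<in> {x. 1 - h p * x \<noteq> 0}" for x
  proof (rule collect_powers, rule clear_denominators[OF S])
    show D: "1 - h p * x \<noteq> 0" using that by simp
    have r: "h p * S * (x / S) = h p * x" using S by simp
    have q: "phit V (S, t, u, p, q) = m + q * n" for q
      unfolding phit_explicit[OF c] m_def n_def z tau by (simp add: algebra_simps)
    have s: "phiS V (S, t, u, p, q) = B" for q
      unfolding phiS_explicit[OF c] B_def z by (simp add: base_def tau algebra_simps power2_eq_square)
    have ss: "DS1 (phiS V) (S, t, u, p, q, r, 0, 0) - r * DS0 (xi V) (S, t, u, p, q) = A + r * E" for q r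
      unfolding DS1_phiS_explicit[OF c] A_def E_def z
      by (simp add: DS0_def frechet_smooth[OF c(1)] tau tau2 Let_def algebra_simps power2_eq_square power3_eq_cube)
    have "gen_expr V S t u p (x / S) 0 = 0" using ge p D r by simp
    then show "(m + - (\<kappa> * S\<^sup>2 * (x / S) / (1 - h p * x)\<^sup>2) * n) + (2 * \<kappa> * S * (x / S) * xi V z
      + 2 * \<kappa> * deriv h p * S ^ 3 * (x / S)\<^sup>2 * B
      + \<kappa> * S\<^sup>2 * (1 + h p * S * (x / S)) * (A + (x / S) * E)) / (1 - h p * x) ^ 3 = 0"
      unfolding gen_expr_def Let_def q s mult_zero_left diff_zero ss r z .
  qed
  from cubic_zero[OF infinite_lin_nonzero this]
  show "m + \<kappa> * S\<^sup>2 * A = 0"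
    "\<kappa> * (2 * xi V z + S * E - S * n) + h p * (\<kappa> * S\<^sup>2 * A - 3 * m) = 0"
    "\<kappa> * S * (h p * (n + E) + 2 * deriv h p * B) + 3 * (h p)\<^sup>2 * m = 0"
    "h p ^ 3 * m = 0" by simp_all
qed

end

subsection \<open>The form of the generators\<close>

context feedback_pde
begin

lemma affine_field_components:
  "xi (affine_field b c \<alpha> \<gamma> \<delta>) = (\<lambda>z. b * fst z)"
  "tau (affine_field b c \<alpha> \<gamma> \<delta>) = (\<lambda>z. c)"
  "phi (affine_field b c \<alpha> \<gamma> \<delta>) = (\<lambda>z. \<alpha> * snd (snd z) + \<gamma> * fst z + \<delta>)"
  by (auto simp: fun_eq_iff xi_def tau_def phi_def affine_field_def)

lemma affine_field_smooth: "smooth_on UNIV (affine_field b c \<alpha> \<gamma> \<delta>)"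
proof -
  define l where "l = (\<lambda>z::jet0. (b * fst z, 0::real, \<alpha> * snd (snd z) + \<gamma> * fst z))"
  have "bounded_linear l"
    unfolding l_def by (intro bounded_linear_intros)
  moreover have "affine_field b c \<alpha> \<gamma> \<delta> = (\<lambda>z. l z + (0, c, \<delta>))"
    by (auto simp: fun_eq_iff affine_field_def l_def)
  ultimately show ?thesis by (simp add: smooth_on_def Ck_on_affine)
qed

lemma partials_affine:
  "pS (\<lambda>z. \<alpha> * snd (snd z) + \<gamma> * fst z + \<delta>) z = \<gamma>"
  "pt (\<lambda>z. \<alpha> * snd (snd z) + \<gamma> * fst z + \<delta>) z = 0"
  "pu (\<lambda>z. \<alpha> * snd (snd z) + \<gamma> * fst z + \<delta>) z = \<alpha>"
proof -
  have "((\<lambda>z::jet0. \<alpha> * snd (snd z) + \<gamma> * fst z + \<delta>) has_derivative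
      (\<lambda>d. \<alpha> * snd (snd d) + \<gamma> * fst d)) (at z)"
    by (rule derivative_eq_intros refl | simp)+
  from frechet_derivative_at[OF this, symmetric]
  show "pS (\<lambda>z. \<alpha> * snd (snd z) + \<gamma> * fst z + \<delta>) z = \<gamma>"
    "pt (\<lambda>z. \<alpha> * snd (snd z) + \<gamma> * fst z + \<delta>) z = 0"
    "pu (\<lambda>z. \<alpha> * snd (snd z) + \<gamma> * fst z + \<delta>) z = \<alpha>"
    by (simp_all add: pS_def pt_def pu_def)
qed

text \<open>What the coefficient of \<open>x^2\<close> demands of an affine field, with
  \<open>m = \<alpha> - b\<close>: the derivative of \<open>(m * p + \<gamma>) * h p\<close>
  vanishes.\<close>

definition compatible :: "real \<Rightarrow> real \<Rightarrow> bool" where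
  "compatible m \<gamma> \<longleftrightarrow> (\<forall>p\<in>P. m * h p + deriv h p * (m * p + \<gamma>) = 0)"

text \<open>Over the common denominator the terms linear in \<open>uSS\<close> cancel identically.
  The quadratic term is \<open>2 * \<kappa> * S^3 * uSS^2\<close> times the compatibility
  expression.\<close>

lemma affine_field_generator:
  assumes "compatible (\<alpha> - b) \<gamma>"
  shows "infinitesimal_generator (pde_domain \<rho> g I) (pde \<sigma> \<rho> g) (affine_field b c \<alpha> \<gamma> \<delta>)"
  unfolding generator_iff
proof (intro conjI allI impI affine_field_smooth)
  fix S t u p r s assume p: "p \<in> P" and D: "1 - h p * S * r \<noteq> 0"
  let ?V = "affine_field b c \<alpha> \<gamma> \<delta>"
  note cs = smooth_components[OF affine_field_smooth[of b c \<alpha> \<gamma> \<delta>]]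
  have X: "pS (xi ?V) z = b" "pt (xi ?V) z = 0" "pu (xi ?V) z = 0" for z
    using partials_affine[of 0 b 0 z] by (simp_all add: affine_field_components)
  have T: "pS (tau ?V) z = 0" "pt (tau ?V) z = 0" "pu (tau ?V) z = 0" for z
    by (simp_all add: affine_field_components)
  have F: "pS (phi ?V) z = \<gamma>" "pt (phi ?V) z = 0" "pu (phi ?V) z = \<alpha>" for z
    by (simp_all add: affine_field_components partials_affine)
  note second = partial_eq_0_if_const[of "pS (xi ?V)", OF X(1)] partial_eq_0_if_const[of "pu (xi ?V)", OF X(3)]
    partial_eq_0_if_const[of "pS (tau ?V)", OF T(1)] partial_eq_0_if_const[of "pu (tau ?V)", OF T(3)]
    partial_eq_0_if_const[of "pS (phi ?V)", OF F(1)] partial_eq_0_if_const[of "pu (phi ?V)", OF F(3)]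
  define d where "d = 1 - h p * S * r"
  define B where "B = \<gamma> + (\<alpha> - b) * p"
  have hB: "deriv h p * B = - ((\<alpha> - b) * h p)"
  proof -
    have "(\<alpha> - b) * h p + deriv h p * ((\<alpha> - b) * p + \<gamma>) = 0"
      using assms p unfolding compatible_def by blast
    then show ?thesis unfolding B_def add.commute[of \<gamma>] by linarith
  qed
  have q: "phit ?V (S, t, u, p, q) = q * \<alpha>" for q
    unfolding phit_explicit[OF cs] by (simp add: X T F)
  have s: "phiS ?V (S, t, u, p, q) = B" for q
    unfolding phiS_explicit[OF cs] B_def by (simp add: X T F algebra_simps)
  have ss: "DS1 (phiS ?V) (S, t, u, p, q, r, s, 0) = r * \<alpha> - r * b" for q
    unfolding DS1_phiS_explicit[OF cs] by (simp add: X T F second Let_def)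
  have D0: "DS0 (xi ?V) (S, t, u, p, q) = b" "DS0 (tau ?V) (S, t, u, p, q) = 0" for q
    by (simp_all add: DS0_def frechet_smooth[OF cs(1)] frechet_smooth[OF cs(2)] X T)
  have d_nz: "d \<noteq> 0" using D by (simp add: d_def)
  have common_denominator: "- (Q / d\<^sup>2) * \<alpha> + N / d ^ 3 = (- (Q * d * \<alpha>) + N) / d ^ 3" for Q N
    using d_nz by (simp add: field_simps power2_eq_square power3_eq_cube)
  have "gen_expr ?V S t u p r s = - (\<kappa> * S\<^sup>2 * r / d\<^sup>2) * \<alpha> + (2 * \<kappa> * S * r * (b * S)
      + 2 * \<kappa> * S ^ 3 * r\<^sup>2 * (deriv h p * B) + \<kappa> * S\<^sup>2 * (1 + h p * S * r) * (r * \<alpha> - r * b - r * b)) / d ^ 3"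
    unfolding gen_expr_def Let_def q s ss D0 d_def[symmetric] by (simp add: affine_field_components mult_ac)
  also have "\<dots> = (- (\<kappa> * S\<^sup>2 * r * d * \<alpha>) + (2 * \<kappa> * S * r * (b * S)
      + 2 * \<kappa> * S ^ 3 * r\<^sup>2 * (deriv h p * B) + \<kappa> * S\<^sup>2 * (1 + h p * S * r) * (r * \<alpha> - r * b - r * b))) / d ^ 3"
    by (rule common_denominator)
  also have "- (k * S\<^sup>2 * r * d * \<alpha>) + (2 * k * S * r * (b * S)
      + 2 * k * S ^ 3 * r\<^sup>2 * (deriv h p * B) + k * S\<^sup>2 * (1 + h p * S * r) * (r * \<alpha> - r * b - r * b)) = 0" for k
    unfolding hB d_def by (simp add: power2_eq_square power3_eq_cube algebra_simps)
  finally show "gen_expr ?V S t u p r s = 0" by simp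
qed

text \<open>All coefficient comparisons are made for \<open>S \<noteq> 0\<close> and extended to \<open>S = 0\<close> by continuity. Smoothness at
  \<open>S = 0\<close> matters: the relation \<open>S \<tau>\<^sub>t + 2 \<xi> = 2 S \<xi>\<^sub>S\<close> alone would allow \<open>\<xi> = S ln S\<close>.\<close>

lemma generator_is_affine_field:
  assumes gen: "infinitesimal_generator (pde_domain \<rho> g I) (pde \<sigma> \<rho> g) V"
    and p0: "p0 \<in> P" "h p0 \<noteq> 0"
  shows "\<exists>b c \<alpha> \<gamma> \<delta>. V = affine_field b c \<alpha> \<gamma> \<delta> \<and> compatible (\<alpha> - b) \<gamma>"
proof -
  let ?X = "xi V" and ?T = "tau V" and ?F = "phi V"
  have sm: "smooth_on UNIV V" using gen unfolding generator_iff by blast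
  note c = smooth_components[OF sm]
  note cX = smooth_on_partials[OF c(1)] and cT = smooth_on_partials[OF c(2)]
    and cF = smooth_on_partials[OF c(3)]
  note ctX = smooth_on_continuous[OF c(1)]
  note ct = cX[THEN smooth_on_continuous] cT[THEN smooth_on_continuous] cF[THEN smooth_on_continuous]
    smooth_on_partials[OF cX(1), THEN smooth_on_continuous]
    smooth_on_partials[OF cX(3), THEN smooth_on_continuous]
    smooth_on_partials[OF cF(1), THEN smooth_on_continuous]
    smooth_on_partials[OF cF(3), THEN smooth_on_continuous]
  note tau = generator_tau[OF gen]
  note red = generator_reduced[OF gen]
  let ?Q = "{p \<in> P. h p \<noteq> 0}"
  have inf: "infinite ?Q" by (rule infinite_h_nonzero[OF p0])

  have off: "pt ?F z = 0 \<and> pt ?X z = 0 \<and> pu ?X z = 0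
      \<and> pS (pS ?F) z = 0 \<and> pu (pS ?F) z + pS (pu ?F) z - pS (pS ?X) z = 0
      \<and> pu (pu ?F) z - pu (pS ?X) z - pS (pu ?X) z = 0
      \<and> S * pt ?T z + 2 * ?X z - 2 * (S * pS ?X z) = 0" if z: "z = (S, t, u)" and S: "S \<noteq> 0" for z S t u
  proof -
    \<comment> \<open>The coefficient of \<open>x^3\<close> is a multiple of
      \<open>h p ^ 3 * m\<close>, so \<open>m\<close> vanishes wherever \<open>h\<close> does
      not.\<close>
    have m: "pt ?F z - p * pt ?X z = 0" if "p \<in> ?Q" for p
      using red(4)[OF S _ z, of p] that by simp
    have "pt ?F z + (- pt ?X z) * p + 0 * p\<^sup>2 + 0 * p ^ 3 = 0" if "p \<in> ?Q" for p
      using m[OF that] by (simp add: algebra_simps)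
    note 1 = cubic_zero(1,2)[OF inf this]
    \<comment> \<open>With \<open>m = 0\<close> the constant coefficient is
      \<open>\<kappa> * S^2 * A\<close>, a cubic in \<open>p\<close>.\<close>
    have A: "pS (pS ?F) z + (pu (pS ?F) z + pS (pu ?F) z - pS (pS ?X) z) * p
         + (pu (pu ?F) z - pu (pS ?X) z - pS (pu ?X) z) * p\<^sup>2 + (- pu (pu ?X) z) * p ^ 3 = 0"
      if "p \<in> ?Q" for p
      using red(1)[OF S _ z, of p] that m[OF that] S sigma by simp
    note 2 = cubic_zero(1-3)[OF inf A]
    \<comment> \<open>With \<open>m = A = 0\<close> the terms with \<open>h\<close> drop out of the
      coefficient of \<open>x\<close>, and \<open>\<phi>\<^sub>u\<close> cancels. What is left is
      affine in \<open>p\<close>.\<close>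
    have "(S * pt ?T z + 2 * ?X z - 2 * (S * pS ?X z)) + (- 2 * S * pu ?X z) * p + 0 * p\<^sup>2 + 0 * p ^ 3 = 0"
      if p: "p \<in> ?Q" for p
    proof -
      have "\<kappa> * (2 * ?X z + S * (pu ?F z - 2 * pS ?X z - 3 * p * pu ?X z)
          - S * (pu ?F z - p * pu ?X z - pt ?T z)) = 0"
        using red(2)[OF S _ z, of p] p unfolding m[OF p] A[OF p] by simp
      then have "2 * ?X z + S * (pu ?F z - 2 * pS ?X z - 3 * p * pu ?X z)
          - S * (pu ?F z - p * pu ?X z - pt ?T z) = 0"
        using kappa_pos by simp
      then show ?thesis by (simp add: algebra_simps)
    qed
    note 3 = cubic_zero(1,2)[OF inf this]
    show ?thesis using 1 2 3 S by simp
  qed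
  note off' = off[OF refl]

  have Ft: "pt ?F z = 0" and Xt: "pt ?X z = 0" and Xu: "pu ?X z = 0" and FSS: "pS (pS ?F) z = 0" for z
  proof -
    obtain S t u where z: "z = (S, t, u)" by (cases z)
    show "pt ?F z = 0" unfolding z by (rule zero_off_plane_imp_zero[OF ct(8)]) (use off' in blast)
    show "pt ?X z = 0" unfolding z by (rule zero_off_plane_imp_zero[OF ct(2)]) (use off' in blast)
    show "pu ?X z = 0" unfolding z by (rule zero_off_plane_imp_zero[OF ct(3)]) (use off' in blast)
    show "pS (pS ?F) z = 0" unfolding z by (rule zero_off_plane_imp_zero[OF ct(16)]) (use off' in blast)
  qed

  have X_indep: "?X (S, t, u) = ?X (S, 0, 0)" for S t u
  proof -
    have "?X (S, t, u) = ?X (S, 0, u)"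
      by (rule DERIV_zero_imp_const[of "\<lambda>x. ?X (S, x, u)"]) (use DERIV_partials(2)[OF c(1)] Xt in metis)
    also have "\<dots> = ?X (S, 0, 0)"
      by (rule DERIV_zero_imp_const[of "\<lambda>x. ?X (S, 0, x)"]) (use DERIV_partials(3)[OF c(1)] Xu in metis)
    finally show ?thesis .
  qed
  have T_indep: "?T (S, t, u) = ?T (0, t, 0)" for S t u
  proof -
    have "?T (S, t, u) = ?T (0, t, u)"
      by (rule DERIV_zero_imp_const[of "\<lambda>x. ?T (x, t, u)"]) (use DERIV_partials(1)[OF c(2)] tau in metis)
    also have "\<dots> = ?T (0, t, 0)"
      by (rule DERIV_zero_imp_const[of "\<lambda>x. ?T (0, t, x)"]) (use DERIV_partials(3)[OF c(2)] tau in metis)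
    finally show ?thesis .
  qed
  have Tt_indep: "pt ?T (S, t, u) = pt ?T (0, t, 0)" for S t u
    using DERIV_partials(2)[OF c(2), of S u t] DERIV_partials(2)[OF c(2), of 0 0 t] DERIV_unique
    unfolding T_indep[of S _ u] by blast

  have euler: "S * pt ?T (S, t, u) + 2 * ?X (S, t, u) - 2 * (S * pS ?X (S, t, u)) = 0" for S t u
  proof -
    have "continuous_on UNIV (\<lambda>z. fst z * pt ?T z + 2 * ?X z - 2 * (fst z * pS ?X z))"
      by (intro continuous_intros ct ctX)
    from zero_off_plane_imp_zero[OF this, of S t u] show ?thesis using off' by simp
  qed
  \<comment> \<open>The derivative in \<open>S\<close> of the preceding relation; it may be taken
    because \<tau> does not depend on \<open>S\<close>.\<close>
  have Tt: "pt ?T (S, t, u) = 2 * S * pS (pS ?X) (S, t, u)" for S t u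
  proof -
    have "((\<lambda>x. x * pt ?T (0, t, 0) + 2 * ?X (x, t, u) - 2 * (x * pS ?X (x, t, u))) has_real_derivative
        pt ?T (0, t, 0) + 2 * pS ?X (S, t, u) - 2 * (pS ?X (S, t, u) + pS (pS ?X) (S, t, u) * S)) (at S)"
      by (rule derivative_eq_intros DERIV_partials(1)[OF c(1)] DERIV_partials(1)[OF cX(1)] refl)+ simp
    moreover have "x * pt ?T (0, t, 0) + 2 * ?X (x, t, u) - 2 * (x * pS ?X (x, t, u)) = 0" for x
      using euler[of x t u] unfolding Tt_indep[of x] .
    ultimately have "((\<lambda>x. 0) has_real_derivative
        pt ?T (0, t, 0) + 2 * pS ?X (S, t, u) - 2 * (pS ?X (S, t, u) + pS (pS ?X) (S, t, u) * S)) (at S)"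
      by simp
    from DERIV_unique[OF this DERIV_const] show ?thesis unfolding Tt_indep[of S t u] by simp
  qed
  \<comment> \<open>At \<open>S = 0\<close> the right-hand side vanishes because
    \<open>\<xi>\<^sub>S\<^sub>S\<close> is finite there. This is where \<open>S ln S\<close> is
    excluded, since it has \<open>S * \<xi>\<^sub>S\<^sub>S = 1\<close>.\<close>
  have Tt0: "pt ?T (S, t, u) = 0" for S t u
    using Tt[of 0 t 0] Tt_indep[of S t u] by simp
  have XSS: "pS (pS ?X) (S, t, u) = 0" for S t u
    by (rule zero_off_plane_imp_zero) (use ct Tt Tt0 in auto)
  define b where "b = pS ?X (0, 0, 0)"
  have X: "?X (S, t, u) = b * S" and XS: "pS ?X (S, t, u) = b" for S t u
  proof -
    have XSS': "((\<lambda>x. pS ?X (x, t, u)) has_real_derivative 0) (at S)" for S t u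
      using DERIV_partials(1)[OF cX(1), of t u S] XSS by simp
    note aff = affine_of_second_DERIV_zero[OF DERIV_partials(1)[OF c(1)] XSS']
    have "?X (0, 0, 0) = 0" using euler[of 0 0 0] by simp
    then show "?X (S, t, u) = b * S" using X_indep[of S t u] aff(1)[of S 0 0] by (simp add: b_def)
    have "((\<lambda>x. ?X (x, t, u)) has_real_derivative pS ?X (S, t, u)) (at S)"
      "((\<lambda>x. ?X (x, 0, 0)) has_real_derivative pS ?X (S, 0, 0)) (at S)"
      by (rule DERIV_partials(1)[OF c(1)])+
    then have "pS ?X (S, t, u) = pS ?X (S, 0, 0)"
      unfolding X_indep[of _ t u] by (rule DERIV_unique)
    then show "pS ?X (S, t, u) = b" using aff(2)[of S 0 0] by (simp add: b_def)
  qed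
  have XS': "pS ?X z = b" for z using XS by (cases z) auto
  note zero2 = partial_eq_0_if_const[of "pS ?X", OF XS'] partial_eq_0_if_const[of "pu ?X", OF Xu]
  define c0 where "c0 = ?T (0, 0, 0)"
  have T: "?T (S, t, u) = c0" for S t u
  proof -
    have "?T (0, t, 0) = ?T (0, 0, 0)"
      by (rule DERIV_zero_imp_const[of "\<lambda>x. ?T (0, x, 0)"]) (use DERIV_partials(2)[OF c(2)] Tt0 in metis)
    then show ?thesis using T_indep[of S t u] by (simp add: c0_def)
  qed

  have Fuu: "pu (pu ?F) (S, t, u) = 0" for S t u
    by (rule zero_off_plane_imp_zero) (use ct off' zero2 in auto)
  have mixed: "pu (pS ?F) (S, t, u) + pS (pu ?F) (S, t, u) = 0" for S t u
  proof -
    have "continuous_on UNIV (\<lambda>z. pu (pS ?F) z + pS (pu ?F) z)"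
      by (intro continuous_intros ct)
    from zero_off_plane_imp_zero[OF this, of S t u] show ?thesis using off' zero2 by simp
  qed
  have Fu_aff: "?F (S, t, u) = ?F (S, 0, 0) + pu ?F (S, 0, 0) * u" for S t u
  proof -
    have "?F (S, t, u) = ?F (S, 0, u)"
      by (rule DERIV_zero_imp_const[of "\<lambda>x. ?F (S, x, u)"]) (use DERIV_partials(2)[OF c(3)] Ft in metis)
    also have "((\<lambda>x. pu ?F (S, 0, x)) has_real_derivative 0) (at x)" for x
      using DERIV_partials(3)[OF cF(3), of S 0 x] Fuu by simp
    note affine_of_second_DERIV_zero(1)[OF DERIV_partials(3)[OF c(3)] this]
    finally show ?thesis .
  qed
  have FS_aff: "?F (S, t, u) = ?F (0, t, u) + pS ?F (0, t, u) * S" for S t u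
  proof -
    have "((\<lambda>x. pS ?F (x, t, u)) has_real_derivative 0) (at x)" for x
      using DERIV_partials(1)[OF cF(1), of t u x] FSS by simp
    from affine_of_second_DERIV_zero(1)[OF DERIV_partials(1)[OF c(3)] this] show ?thesis .
  qed
  \<comment> \<open>\<phi> is affine in \<open>u\<close> and affine in \<open>S\<close>, hence
    bilinear up to lower terms; \<beta> is the coefficient of \<open>S * u\<close>, the change of
    the slope in \<open>S\<close> from \<open>u = 0\<close> to \<open>u = 1\<close>.\<close>
  define \<delta> \<alpha> \<gamma> \<beta> where "\<delta> = ?F (0, 0, 0)" and "\<alpha> = pu ?F (0, 0, 0)" and "\<gamma> = pS ?F (0, 0, 0)"
    and "\<beta> = pS ?F (0, 0, 1) - pS ?F (0, 0, 0)"
  have pu_eq: "pu ?F (S, 0, 0) = \<alpha> + \<beta> * S" for S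
    using Fu_aff[of S 0 1] Fu_aff[of 0 0 1] FS_aff[of S 0 0] FS_aff[of S 0 1]
    by (simp add: \<alpha>_def \<beta>_def algebra_simps)
  have F_bi: "?F (S, t, u) = \<alpha> * u + \<beta> * S * u + \<gamma> * S + \<delta>" for S t u
    using Fu_aff[of S t u] FS_aff[of S 0 0] unfolding pu_eq
    by (simp add: \<gamma>_def \<delta>_def algebra_simps)
  have FS: "pS ?F (S, t, u) = \<beta> * u + \<gamma>" and Fu: "pu ?F (S, t, u) = \<alpha> + \<beta> * S" for S t u
  proof -
    have "((\<lambda>x. ?F (x, t, u)) has_real_derivative \<beta> * u + \<gamma>) (at S)"
      "((\<lambda>x. ?F (S, t, x)) has_real_derivative \<alpha> + \<beta> * S) (at u)"
      unfolding F_bi by (auto intro!: derivative_eq_intros)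
    then show "pS ?F (S, t, u) = \<beta> * u + \<gamma>" "pu ?F (S, t, u) = \<alpha> + \<beta> * S"
      using DERIV_unique DERIV_partials(1,3)[OF c(3)] by metis+
  qed
  \<comment> \<open>Both mixed partials equal \<beta>, while their sum is zero because
    \<open>\<xi>\<^sub>S\<^sub>S = 0\<close>.\<close>
  have "\<beta> = 0"
  proof -
    have "((\<lambda>x. pS ?F (0, 0, x)) has_real_derivative \<beta>) (at 0)"
      "((\<lambda>x. pu ?F (x, 0, 0)) has_real_derivative \<beta>) (at 0)"
      unfolding FS Fu by (auto intro!: derivative_eq_intros)
    then have "pu (pS ?F) (0, 0, 0) = \<beta>" "pS (pu ?F) (0, 0, 0) = \<beta>"
      using DERIV_unique DERIV_partials(3)[OF cF(1)] DERIV_partials(1)[OF cF(3)] by metis+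
    then show ?thesis using mixed[of 0 0 0] by simp
  qed
  have "V z = affine_field b c0 \<alpha> \<gamma> \<delta> z" for z
  proof -
    obtain S t u where z: "z = (S, t, u)" by (cases z)
    have "V z = (?X z, ?T z, ?F z)" by (simp add: xi_def tau_def phi_def)
    then show ?thesis using X T F_bi \<open>\<beta> = 0\<close> by (simp add: z affine_field_def)
  qed
  moreover have "compatible (\<alpha> - b) \<gamma>"
    unfolding compatible_def
  proof
    fix p assume p: "p \<in> P"
    \<comment> \<open>The coefficient of \<open>x^2\<close> at \<open>S = 1\<close>, for every
      \<open>p\<close> in \<open>P\<close>, zeros of \<open>h\<close> included.\<close>
    have "\<kappa> * 1 * (h p * (2 * \<alpha> - 2 * b) + 2 * deriv h p * (\<gamma> + p * \<alpha> - p * b)) = 0"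
      using red(3)[of 1 p "(1, 0, 0)" 0 0, OF _ p refl]
      by (simp add: Ft Xt Xu XS Tt0 FS Fu \<open>\<beta> = 0\<close> algebra_simps)
    then have "h p * (2 * \<alpha> - 2 * b) + 2 * deriv h p * (\<gamma> + p * \<alpha> - p * b) = 0"
      using kappa_pos by simp
    then show "(\<alpha> - b) * h p + deriv h p * ((\<alpha> - b) * p + \<gamma>) = 0"
      by (simp add: algebra_simps)
  qed
  ultimately show ?thesis by blast
qed

end

subsection \<open>The logarithmic derivative of g\<close>

text \<open>Counts parameters: an injective linear parametrization carries the standard basis to a
  basis of its range.\<close>

lemma dim_range_injective:
  fixes f :: "'a::euclidean_space \<Rightarrow> 'b::real_vector"
  assumes "linear f" "inj f"
  shows "independent (f ` Basis)" "card (f ` Basis) = DIM('a)" "dim (range f) = DIM('a)"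
proof -
  show ind: "independent (f ` Basis)"
    using assms independent_Basis by (intro linear_independent_injective_image) auto
  show card: "card (f ` Basis) = DIM('a)"
    using assms(2) by (simp add: card_image inj_on_subset)
  have "span (f ` Basis) = range f"
    using assms(1) by (simp add: linear_span_image)
  then show "dim (range f) = DIM('a)"
    using dim_unique[of "f ` Basis" "range f"] ind card by auto
qed

lemma real_power_eq_0_iff: "real_power x c = 0 \<longleftrightarrow> x = 0"
  by (simp add: real_power_def)

text \<open>Writing \<open>\<bar>y\<bar> powr c\<close> as \<open>exp (c / 2 * ln (y^2))\<close>
  treats both signs of the base at once.\<close>

lemma DERIV_real_power_affine:
  assumes "a + k * x \<noteq> 0"
  shows "((\<lambda>x. real_power (a + k * x) c) has_real_derivative
    real_power (a + k * x) c * (c * k / (a + k * x))) (at x)"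
proof -
  have eq: "real_power y c = exp (c / 2 * ln (y\<^sup>2))" if "y \<noteq> 0" for y
  proof -
    have "ln (y\<^sup>2) = ln (\<bar>y\<bar> ^ 2)" by simp
    also have "\<dots> = 2 * ln \<bar>y\<bar>" using that by (subst ln_realpow) auto
    finally show ?thesis using that by (simp add: real_power_def powr_def)
  qed
  have "((\<lambda>x. exp (c / 2 * ln ((a + k * x)\<^sup>2))) has_real_derivative
      exp (c / 2 * ln ((a + k * x)\<^sup>2)) * (c / 2 * ((2 * (a + k * x) * k) / (a + k * x)\<^sup>2))) (at x)"
    using assms by (auto intro!: derivative_eq_intros) (simp add: divide_simps algebra_simps)
  moreover have "c / 2 * ((2 * y * k) / y\<^sup>2) = c * k / y" for y
    by (cases "y = 0") (simp_all add: power2_eq_square)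
  ultimately have d: "((\<lambda>x. exp (c / 2 * ln ((a + k * x)\<^sup>2))) has_real_derivative
      real_power (a + k * x) c * (c * k / (a + k * x))) (at x)"
    unfolding eq[OF assms] by (simp only:)
  have "open {x. a + k * x \<noteq> 0}" by (intro open_Collect_neq continuous_intros)
  with d show ?thesis
    by (rule has_field_derivative_transform_within_open[where S = "{x. a + k * x \<noteq> 0}"])
      (use assms eq in auto)
qed

context feedback_pde
begin

text \<open>The compatibility expression is the derivative of the product, and \<open>P\<close> is
  open and connected.\<close>

lemma compatible_iff: "compatible m \<gamma> \<longleftrightarrow> (\<exists>C. \<forall>p\<in>P. (m * p + \<gamma>) * h p = C)"
proof
  have d: "((\<lambda>p. (m * p + \<gamma>) * h p) has_real_derivative m * h p + deriv h p * (m * p + \<gamma>)) (at p)"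
    if "p \<in> P" for p
    by (rule derivative_eq_intros h_DERIV[OF that] refl)+ simp
  {
    assume "compatible m \<gamma>"
    then have d0: "((\<lambda>p. (m * p + \<gamma>) * h p) has_real_derivative 0) (at p)" if "p \<in> P" for p
      using d[OF that] that unfolding compatible_def by simp
    then have "continuous_on P (\<lambda>p. (m * p + \<gamma>) * h p)"
      by (intro continuous_at_imp_continuous_on ballI DERIV_isCont)
    then have "(\<lambda>p. (m * p + \<gamma>) * h p) constant_on P"
      using d0 by (intro DERIV_zero_connected_constant_on[OF connected_P open_P finite.emptyI]) auto
    then show "\<exists>C. \<forall>p\<in>P. (m * p + \<gamma>) * h p = C" unfolding constant_on_def .
  }
  assume "\<exists>C. \<forall>p\<in>P. (m * p + \<gamma>) * h p = C"
  then obtain C where C: "\<And>p. p \<in> P \<Longrightarrow> (m * p + \<gamma>) * h p = C" by blast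
  show "compatible m \<gamma>"
    unfolding compatible_def
  proof
    fix p assume p: "p \<in> P"
    have "((\<lambda>p. C) has_real_derivative m * h p + deriv h p * (m * p + \<gamma>)) (at p)"
      by (rule has_field_derivative_transform_within_open[OF d[OF p] open_P p C])
    from DERIV_unique[OF this DERIV_const] show "m * h p + deriv h p * (m * p + \<gamma>) = 0" .
  qed
qed

lemma g_DERIV:
  assumes "\<alpha> \<in> I"
  shows "(g has_real_derivative g \<alpha> * (h (\<alpha> / \<rho>) / \<rho>)) (at \<alpha>)"
proof -
  have "g differentiable (at \<alpha>)"
    using g_diff interval(1) assms by (simp add: differentiable_on_eq_differentiable_at)
  then have "(g has_real_derivative deriv g \<alpha>) (at \<alpha>)"
    by (simp add: DERIV_deriv_iff_real_differentiable)
  moreover have "deriv g \<alpha> = g \<alpha> * (h (\<alpha> / \<rho>) / \<rho>)"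
    using g_nz[OF assms] rho by (simp add: h_def)
  ultimately show ?thesis by simp
qed

text \<open>\<open>g / E\<close> has derivative zero on the interval \<open>I\<close>; its constant
  value is nonzero because \<open>g\<close> has no zeros.\<close>

lemma proportional_if_log_deriv_eq:
  assumes "\<And>\<alpha>. \<alpha> \<in> I \<Longrightarrow> E \<alpha> \<noteq> 0"
    and "\<And>\<alpha>. \<alpha> \<in> I \<Longrightarrow> (E has_real_derivative E \<alpha> * (h (\<alpha> / \<rho>) / \<rho>)) (at \<alpha>)"
  shows "\<exists>c. c \<noteq> 0 \<and> (\<forall>\<alpha>\<in>I. g \<alpha> = c * E \<alpha>)"
proof -
  have d: "((\<lambda>\<alpha>. g \<alpha> / E \<alpha>) has_real_derivative 0) (at \<alpha>)" if "\<alpha> \<in> I" for \<alpha>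
    by (rule derivative_eq_intros g_DERIV[OF that] assms[OF that] refl)+ simp
  then have "continuous_on I (\<lambda>\<alpha>. g \<alpha> / E \<alpha>)"
    by (intro continuous_at_imp_continuous_on ballI DERIV_isCont)
  then have "(\<lambda>\<alpha>. g \<alpha> / E \<alpha>) constant_on I"
    using d interval by (intro DERIV_zero_connected_constant_on[OF is_interval_connected _ finite.emptyI]) auto
  then obtain c where c: "\<And>\<alpha>. \<alpha> \<in> I \<Longrightarrow> g \<alpha> / E \<alpha> = c" unfolding constant_on_def by blast
  obtain \<alpha>0 where "\<alpha>0 \<in> I" using interval(3) by blast
  then have "c \<noteq> 0" using c[of \<alpha>0] g_nz assms(1) by auto
  moreover have "g \<alpha> = c * E \<alpha>" if "\<alpha> \<in> I" for \<alpha>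
    using c[OF that] assms(1)[OF that] by (simp add: field_simps)
  ultimately show ?thesis by blast
qed

lemma h_if_proportional:
  assumes g: "\<And>\<alpha>. \<alpha> \<in> I \<Longrightarrow> g \<alpha> = c * E \<alpha>"
    and E: "\<And>\<alpha>. \<alpha> \<in> I \<Longrightarrow> (E has_real_derivative E \<alpha> * L \<alpha>) (at \<alpha>)"
    and p: "p \<in> P"
  shows "h p = \<rho> * L (\<rho> * p)"
proof -
  have a: "\<rho> * p \<in> I" using p by (simp add: P_def)
  have "((\<lambda>\<alpha>. c * E \<alpha>) has_real_derivative c * (E (\<rho> * p) * L (\<rho> * p))) (at (\<rho> * p))"
    by (rule DERIV_cmult E a)+
  then have "(g has_real_derivative c * (E (\<rho> * p) * L (\<rho> * p))) (at (\<rho> * p))"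
    by (rule has_field_derivative_transform_within_open[OF _ interval(1) a]) (simp add: g)
  then have "deriv g (\<rho> * p) = g (\<rho> * p) * L (\<rho> * p)"
    unfolding g[OF a] mult.assoc by (rule DERIV_imp_deriv)
  then show ?thesis using g_nz[OF a] by (simp add: h_def)
qed

abbreviation special_form :: bool where
  "special_form \<equiv>
    (\<exists>c1 c2. c1 \<noteq> 0 \<and> c2 \<noteq> 0 \<and> (\<forall>\<alpha>\<in>I. g \<alpha> = c2 * exp (c1 * \<alpha>))) \<or>
    (\<exists>c1 c2. c1 \<noteq> 0 \<and> c2 \<noteq> 0 \<and> (\<forall>\<alpha>\<in>I. g \<alpha> = c2 * real_power \<alpha> c1)) \<or>
    (\<exists>c1 c2 k. c1 \<noteq> 0 \<and> c2 \<noteq> 0 \<and> k \<noteq> 0 \<and>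
       (\<forall>\<alpha>\<in>I. g \<alpha> = c2 * real_power (\<rho> + k * \<alpha>) (- 1 / c1)))"

text \<open>The pairs \<open>(m, \<gamma>)\<close> are (0, 1) for the exponential, (1, 0) for the
  power and \<open>(k, 1)\<close> for the shifted power; \<open>C\<close> is
  \<open>\<rho> * c1\<close>, \<open>c1\<close> and \<open>- k / c1\<close>. The bases of the powers
  are nonzero on \<open>I\<close> since \<open>g\<close> is.\<close>

lemma special_form_imp:
  assumes special_form
  shows "\<exists>m \<gamma> C. C \<noteq> 0 \<and> (\<forall>p\<in>P. (m * p + \<gamma>) * h p = C)"
  using assms
proof (elim disjE exE conjE)
  fix c1 c2 assume c: "c1 \<noteq> 0" "c2 \<noteq> 0" and g: "\<forall>\<alpha>\<in>I. g \<alpha> = c2 * exp (c1 * \<alpha>)"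
  have "h p = \<rho> * c1" if "p \<in> P" for p
    using g that by (intro h_if_proportional[of c2 "\<lambda>\<alpha>. exp (c1 * \<alpha>)"]) (auto intro!: derivative_eq_intros)
  then have "\<forall>p\<in>P. (0 * p + 1) * h p = \<rho> * c1" by simp
  moreover have "\<rho> * c1 \<noteq> 0" using c rho by simp
  ultimately show ?thesis by blast
next
  fix c1 c2 assume c: "c1 \<noteq> 0" "c2 \<noteq> 0" and g: "\<forall>\<alpha>\<in>I. g \<alpha> = c2 * real_power \<alpha> c1"
  have nz: "\<alpha> \<noteq> 0" if "\<alpha> \<in> I" for \<alpha>
    using g_nz[OF that] g that by (auto simp: real_power_eq_0_iff)
  have h: "h p = \<rho> * (c1 / (\<rho> * p))" if "p \<in> P" for p
  proof (rule h_if_proportional[OF _ _ that])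
    show "g \<alpha> = c2 * real_power \<alpha> c1" if "\<alpha> \<in> I" for \<alpha> using g that by blast
    show "((\<lambda>\<alpha>. real_power \<alpha> c1) has_real_derivative real_power \<alpha> c1 * (c1 / \<alpha>)) (at \<alpha>)"
      if "\<alpha> \<in> I" for \<alpha>
      using DERIV_real_power_affine[of 0 1 \<alpha> c1] nz[OF that] by simp
  qed
  have "(1 * p + 0) * h p = c1" if "p \<in> P" for p
    using h[OF that] nz[of "\<rho> * p"] that rho by (simp add: P_def)
  then show ?thesis using c by blast
next
  fix c1 c2 k assume c: "c1 \<noteq> 0" "c2 \<noteq> 0" "k \<noteq> 0"
    and g: "\<forall>\<alpha>\<in>I. g \<alpha> = c2 * real_power (\<rho> + k * \<alpha>) (- 1 / c1)"
  have nz: "\<rho> + k * \<alpha> \<noteq> 0" if "\<alpha> \<in> I" for \<alpha>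
    using g_nz[OF that] g that by (auto simp: real_power_eq_0_iff)
  have h: "h p = \<rho> * ((- 1 / c1) * k / (\<rho> + k * (\<rho> * p)))" if "p \<in> P" for p
  proof (rule h_if_proportional[OF _ _ that])
    show "g \<alpha> = c2 * real_power (\<rho> + k * \<alpha>) (- 1 / c1)" if "\<alpha> \<in> I" for \<alpha> using g that by blast
    show "((\<lambda>\<alpha>. real_power (\<rho> + k * \<alpha>) (- 1 / c1)) has_real_derivative
        real_power (\<rho> + k * \<alpha>) (- 1 / c1) * ((- 1 / c1) * k / (\<rho> + k * \<alpha>))) (at \<alpha>)"
      if "\<alpha> \<in> I" for \<alpha>
      by (rule DERIV_real_power_affine[OF nz[OF that]])
  qed
  have "(k * p + 1) * h p = - k / c1" if "p \<in> P" for p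
  proof -
    have eq: "\<rho> + k * (\<rho> * p) = \<rho> * (k * p + 1)" by (simp add: algebra_simps)
    have "k * p + 1 \<noteq> 0" using nz[of "\<rho> * p"] that unfolding eq by (simp add: P_def)
    then show ?thesis unfolding h[OF that] eq using rho by simp
  qed
  moreover have "- k / c1 \<noteq> 0" using c by simp
  ultimately show ?thesis by blast
qed

text \<open>In the variable \<alpha> the logarithmic derivative of \<open>g\<close> is
  \<open>C / (m * \<alpha> + \<gamma> * \<rho>)\<close>. The three families are its integrals for
  \<open>m = 0\<close>, for \<open>\<gamma> = 0\<close>, and for both nonzero.\<close>

lemma special_form_if:
  assumes C: "C \<noteq> 0" and mh: "\<And>p. p \<in> P \<Longrightarrow> (m * p + \<gamma>) * h p = C"
  shows special_form
proof -
  have mh': "(m * \<alpha> + \<gamma> * \<rho>) * (h (\<alpha> / \<rho>) / \<rho>) = C" and nz: "m * \<alpha> + \<gamma> * \<rho> \<noteq> 0" if "\<alpha> \<in> I" for \<alpha>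
  proof -
    have "\<alpha> / \<rho> \<in> P" using that rho by (simp add: P_def)
    from mh[OF this] show *: "(m * \<alpha> + \<gamma> * \<rho>) * (h (\<alpha> / \<rho>) / \<rho>) = C"
      using rho by (simp add: field_simps)
    show "m * \<alpha> + \<gamma> * \<rho> \<noteq> 0" using * C by auto
  qed
  have h_eq: "h (\<alpha> / \<rho>) / \<rho> = C / (m * \<alpha> + \<gamma> * \<rho>)" if "\<alpha> \<in> I" for \<alpha>
    using mh'[OF that] nz[OF that] by (simp add: field_simps)
  obtain \<alpha>0 where \<alpha>0: "\<alpha>0 \<in> I" using interval(3) by blast
  consider (exp) "m = 0" | (power) "m \<noteq> 0" "\<gamma> = 0" | (shifted) "m \<noteq> 0" "\<gamma> \<noteq> 0" by blast
  then show ?thesis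
  proof cases
    case exp
    then have "\<gamma> \<noteq> 0" using nz[OF \<alpha>0] by auto
    define c1 where "c1 = C / (\<gamma> * \<rho>)"
    have "c1 \<noteq> 0" using C \<open>\<gamma> \<noteq> 0\<close> rho by (simp add: c1_def)
    moreover have "\<exists>c2. c2 \<noteq> 0 \<and> (\<forall>\<alpha>\<in>I. g \<alpha> = c2 * exp (c1 * \<alpha>))"
      by (rule proportional_if_log_deriv_eq)
        (use \<open>\<gamma> \<noteq> 0\<close> rho in \<open>auto intro!: derivative_eq_intros simp: h_eq exp c1_def\<close>)
    ultimately show ?thesis by blast
  next
    case power
    have a: "\<alpha> \<noteq> 0" if "\<alpha> \<in> I" for \<alpha> using nz[OF that] power by auto
    have "\<exists>c2. c2 \<noteq> 0 \<and> (\<forall>\<alpha>\<in>I. g \<alpha> = c2 * real_power \<alpha> (C / m))"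
    proof (rule proportional_if_log_deriv_eq)
      fix \<alpha> assume \<alpha>: "\<alpha> \<in> I"
      show "real_power \<alpha> (C / m) \<noteq> 0" using a[OF \<alpha>] by (simp add: real_power_eq_0_iff)
      show "((\<lambda>\<alpha>. real_power \<alpha> (C / m)) has_real_derivative
          real_power \<alpha> (C / m) * (h (\<alpha> / \<rho>) / \<rho>)) (at \<alpha>)"
        using DERIV_real_power_affine[of 0 1 \<alpha> "C / m"] a[OF \<alpha>] unfolding h_eq[OF \<alpha>]
        by (simp add: power)
    qed
    moreover have "C / m \<noteq> 0" using C power by simp
    ultimately show ?thesis by blast
  next
    case shifted
    \<comment> \<open>Dividing the base by \<gamma> turns it into
      \<open>\<rho> + k * \<alpha>\<close>; the exponent \<open>C / m\<close> has to equal
      \<open>- 1 / c1\<close>.\<close>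
    define c1 k where "c1 = - m / C" and "k = m / \<gamma>"
    have eq: "\<rho> + k * \<alpha> = (m * \<alpha> + \<gamma> * \<rho>) / \<gamma>" for \<alpha>
      using shifted by (simp add: k_def field_simps)
    have a: "\<rho> + k * \<alpha> \<noteq> 0" if "\<alpha> \<in> I" for \<alpha> using nz[OF that] shifted by (simp add: eq)
    have "\<exists>c2. c2 \<noteq> 0 \<and> (\<forall>\<alpha>\<in>I. g \<alpha> = c2 * real_power (\<rho> + k * \<alpha>) (- 1 / c1))"
    proof (rule proportional_if_log_deriv_eq)
      fix \<alpha> assume \<alpha>: "\<alpha> \<in> I"
      show "real_power (\<rho> + k * \<alpha>) (- 1 / c1) \<noteq> 0" using a[OF \<alpha>] by (simp add: real_power_eq_0_iff)
      have "(- 1 / c1) * k / (\<rho> + k * \<alpha>) = h (\<alpha> / \<rho>) / \<rho>"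
        unfolding h_eq[OF \<alpha>] eq using shifted C by (simp add: c1_def k_def)
      then show "((\<lambda>\<alpha>. real_power (\<rho> + k * \<alpha>) (- 1 / c1)) has_real_derivative
          real_power (\<rho> + k * \<alpha>) (- 1 / c1) * (h (\<alpha> / \<rho>) / \<rho>)) (at \<alpha>)"
        using DERIV_real_power_affine[OF a[OF \<alpha>], of "- 1 / c1"] by simp
    qed
    moreover have "c1 \<noteq> 0" "k \<noteq> 0" using C shifted by (auto simp: c1_def k_def)
    ultimately show ?thesis by blast
  qed
qed

end

subsection \<open>Dimension of the symmetry algebra\<close>

context feedback_pde
begin

abbreviation generators :: "vfield set" where
  "generators \<equiv> symmetry_algebra (pde_domain \<rho> g I) (pde \<sigma> \<rho> g)"

lemma generators_eq:
  assumes "p0 \<in> P" "h p0 \<noteq> 0"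
  shows "generators = {affine_field b c \<alpha> \<gamma> \<delta> |b c \<alpha> \<gamma> \<delta>. compatible (\<alpha> - b) \<gamma>}"
  using generator_is_affine_field[OF _ assms] affine_field_generator
  unfolding symmetry_algebra_def by blast

lemma affine_field_eq_iff:
  "affine_field b c \<alpha> \<gamma> \<delta> = affine_field b' c' \<alpha>' \<gamma>' \<delta>' \<longleftrightarrow> b = b' \<and> c = c' \<and> \<alpha> = \<alpha>' \<and> \<gamma> = \<gamma>' \<and> \<delta> = \<delta>'"
proof
  assume eq: "affine_field b c \<alpha> \<gamma> \<delta> = affine_field b' c' \<alpha>' \<gamma>' \<delta>'"
  show "b = b' \<and> c = c' \<and> \<alpha> = \<alpha>' \<and> \<gamma> = \<gamma>' \<and> \<delta> = \<delta>'"
    using fun_cong[OF eq, of "(0, 0, 0)"] fun_cong[OF eq, of "(1, 0, 0)"] fun_cong[OF eq, of "(0, 0, 1)"]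
    by (simp add: affine_field_def)
qed simp

lemma affine_field_add: "affine_field b c \<alpha> \<gamma> \<delta> + affine_field b' c' \<alpha>' \<gamma>' \<delta>' = affine_field (b + b') (c + c') (\<alpha> + \<alpha>') (\<gamma> + \<gamma>') (\<delta> + \<delta>')"
  by (auto simp: affine_field_def fun_eq_iff algebra_simps)

lemma affine_field_scale: "r *\<^sub>R affine_field b c \<alpha> \<gamma> \<delta> = affine_field (r * b) (r * c) (r * \<alpha>) (r * \<gamma>) (r * \<delta>)"
  by (auto simp: affine_field_def fun_eq_iff scaleR_fun_def algebra_simps)

lemma lie_bracket_affine_field:
  "lie_bracket (affine_field b c \<alpha> \<gamma> \<delta>) (affine_field b' c' \<alpha>' \<gamma>' \<delta>') =
    affine_field 0 0 0 (\<alpha>' * \<gamma> + \<gamma>' * b - \<alpha> * \<gamma>' - \<gamma> * b') (\<alpha>' * \<delta> - \<alpha> * \<delta>')"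
proof -
  have d: "frechet_derivative (affine_field b c \<alpha> \<gamma> \<delta>) (at z) =
      (\<lambda>w. (b * fst w, 0, \<alpha> * snd (snd w) + \<gamma> * fst w))" for b c \<alpha> \<gamma> \<delta> z
  proof -
    have eq: "affine_field b c \<alpha> \<gamma> \<delta> = (\<lambda>w. (b * fst w, c, \<alpha> * snd (snd w) + \<gamma> * fst w + \<delta>))"
      by (auto simp: affine_field_def fun_eq_iff)
    have "((\<lambda>w. (b * fst w, c, \<alpha> * snd (snd w) + \<gamma> * fst w + \<delta>)) has_derivative
        (\<lambda>w. (b * fst w, 0, \<alpha> * snd (snd w) + \<gamma> * fst w))) (at z)"
      by (rule derivative_eq_intros refl | simp)+
    then show ?thesis unfolding eq by (rule frechet_derivative_at[symmetric])
  qed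
  show ?thesis unfolding lie_bracket_def d by (auto simp: affine_field_def fun_eq_iff algebra_simps)
qed

section \<open>The space of compatible pairs\<close>

lemma compatible_0: "compatible 0 0"
  by (simp add: compatible_def)

text \<open>If \<open>C\<close> were 0, the affine function would vanish at the infinitely many
  points where \<open>h\<close> does not.\<close>

lemma const_nonzero:
  assumes "p0 \<in> P" "h p0 \<noteq> 0" and "(m, \<gamma>) \<noteq> (0, 0)" and C: "\<And>p. p \<in> P \<Longrightarrow> (m * p + \<gamma>) * h p = C"
  shows "C \<noteq> 0"
proof
  assume "C = 0"
  then have "m * p + \<gamma> = 0" if "p \<in> {p \<in> P. h p \<noteq> 0}" for p
    using C[of p] that by simp
  then have "\<gamma> + m * p + 0 * p\<^sup>2 + 0 * p ^ 3 = 0" if "p \<in> {p \<in> P. h p \<noteq> 0}" for p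
    using that by (simp add: add.commute)
  from cubic_zero(1,2)[OF infinite_h_nonzero[OF assms(1,2)] this] assms(3) show False by simp
qed

text \<open>Eliminating \<open>h\<close> from the two relations leaves an affine function of
  \<open>p\<close> with infinitely many zeros, so the pairs are proportional with factor
  \<open>C' / C\<close>. Hence at most one parameter is added to the three free ones.\<close>

lemma compatible_unique:
  assumes p0: "p0 \<in> P" "h p0 \<noteq> 0" and nz: "(m, \<gamma>) \<noteq> (0, 0)"
    and comp: "compatible m \<gamma>" "compatible m' \<gamma>'"
  shows "\<exists>s. m' = s * m \<and> \<gamma>' = s * \<gamma>"
proof -
  obtain C C' where C: "\<And>p. p \<in> P \<Longrightarrow> (m * p + \<gamma>) * h p = C"
    and C': "\<And>p. p \<in> P \<Longrightarrow> (m' * p + \<gamma>') * h p = C'"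
    using comp unfolding compatible_iff by blast
  have "C \<noteq> 0" using const_nonzero[OF p0 nz C] .
  have "(C' * \<gamma> - C * \<gamma>') + (C' * m - C * m') * p + 0 * p\<^sup>2 + 0 * p ^ 3 = 0"
    if p: "p \<in> {p \<in> P. h p \<noteq> 0}" for p
  proof -
    have "(C' * (m * p + \<gamma>) - C * (m' * p + \<gamma>')) * h p = 0"
      using C[of p] C'[of p] p by (simp add: left_diff_distrib mult.assoc)
    then have "C' * (m * p + \<gamma>) - C * (m' * p + \<gamma>') = 0" using p by simp
    then show ?thesis by (simp add: algebra_simps)
  qed
  from cubic_zero(1,2)[OF infinite_h_nonzero[OF p0] this] \<open>C \<noteq> 0\<close>
  have "m' = C' / C * m" "\<gamma>' = C' / C * \<gamma>" by (simp_all add: field_simps)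
  then show ?thesis by blast
qed

text \<open>The equation is then linear. Its full algebra is not computed: five independent affine
  generators already contradict a basis of four elements.\<close>

lemma dim_generators_if_h_zero:
  assumes "\<And>p. p \<in> P \<Longrightarrow> h p = 0"
  shows "dim generators \<noteq> 4"
proof
  assume dim4: "dim generators = 4"
  define f where "f = (\<lambda>(b, c, \<alpha>, \<gamma>, \<delta>). affine_field b c \<alpha> \<gamma> \<delta>)"
  have "linear f"
    by (rule linearI) (auto simp: f_def affine_field_add affine_field_scale)
  moreover have "inj f" by (auto simp: inj_def f_def affine_field_eq_iff)
  ultimately have ind: "independent (f ` Basis)" "card (f ` Basis) = 5"
    using dim_range_injective[of f] by simp_all
  have "compatible m \<gamma>" for m \<gamma> unfolding compatible_iff using assms by simp
  then have "range f \<subseteq> generators"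
    by (auto simp: f_def symmetry_algebra_def affine_field_generator)
  moreover obtain B where "generators \<subseteq> span B" "card B = dim generators"
    using basis_exists by blast
  \<comment> \<open>An infinite set has \<open>card\<close> 0, so \<open>card B = 4\<close> makes
    \<open>B\<close> finite.\<close>
  moreover from this dim4 have "finite B" by (metis card.infinite zero_neq_numeral)
  ultimately show False
    using independent_span_bound[of B "f ` Basis"] ind dim4 by auto
qed

lemma dim_generators_if_trivial:
  assumes p0: "p0 \<in> P" "h p0 \<noteq> 0"
    and triv: "\<And>m \<gamma>. compatible m \<gamma> \<Longrightarrow> m = 0 \<and> \<gamma> = 0"
  shows "dim generators = 3"
proof -
  define f where "f = (\<lambda>(b, c, \<delta>). affine_field b c b 0 \<delta>)"
  have "linear f"
    by (rule linearI) (auto simp: f_def affine_field_add affine_field_scale)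
  moreover have "inj f" by (auto simp: inj_def f_def affine_field_eq_iff)
  moreover have "range f = generators"
  proof
    show "range f \<subseteq> generators"
      unfolding generators_eq[OF p0] using compatible_0 by (force simp: f_def)
    show "generators \<subseteq> range f"
    proof
      fix V assume "V \<in> generators"
      then obtain b c \<alpha> \<gamma> \<delta> where V: "V = affine_field b c \<alpha> \<gamma> \<delta>" "compatible (\<alpha> - b) \<gamma>"
        unfolding generators_eq[OF p0] by blast
      then have "V = f (b, c, \<delta>)" using triv by (force simp: f_def)
      then show "V \<in> range f" by blast
    qed
  qed
  ultimately show ?thesis using dim_range_injective(3)[of f] by simp
qed

lemma admits_4_if_compatible:
  assumes p0: "p0 \<in> P" "h p0 \<noteq> 0" and nz: "(m, \<gamma>) \<noteq> (0, 0)" and comp: "compatible m \<gamma>"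
  shows "admits_lie_algebra_of_dim (pde_domain \<rho> g I) (pde \<sigma> \<rho> g) 4"
proof -
  \<comment> \<open>Every compatible pair is \<open>s\<close> times \<open>(m, \<gamma>)\<close>, so
    \<open>s\<close> replaces the two parameters \<alpha> and \<gamma> of the affine field.\<close>
  define f where "f = (\<lambda>(b, c, \<delta>, s). affine_field b c (b + s * m) (s * \<gamma>) \<delta>)"
  have "linear f"
    by (rule linearI) (auto simp: f_def affine_field_add affine_field_scale algebra_simps)
  moreover have "inj f" using nz by (auto simp: inj_def f_def affine_field_eq_iff)
  moreover have range: "range f = generators"
  proof
    have "compatible (s * m) (s * \<gamma>)" for s
    proof -
      have "s * m * h p + deriv h p * (s * m * p + s * \<gamma>) = s * (m * h p + deriv h p * (m * p + \<gamma>))" for p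
        by (simp add: algebra_simps)
      then show ?thesis using comp by (simp add: compatible_def)
    qed
    then show "range f \<subseteq> generators"
      by (auto simp: f_def symmetry_algebra_def affine_field_generator)
    show "generators \<subseteq> range f"
    proof
      fix V assume "V \<in> generators"
      then obtain b c \<alpha> \<gamma>' \<delta> where V: "V = affine_field b c \<alpha> \<gamma>' \<delta>" "compatible (\<alpha> - b) \<gamma>'"
        unfolding generators_eq[OF p0] by blast
      obtain s where "\<alpha> - b = s * m" "\<gamma>' = s * \<gamma>" using compatible_unique[OF p0 nz comp V(2)] by blast
      then have "V = f (b, c, \<delta>, s)" by (simp add: V(1) f_def affine_field_eq_iff)
      then show "V \<in> range f" by blast
    qed
  qed
  ultimately have "dim generators = 4" "subspace generators"
    using dim_range_injective(3)[of f] linear_subspace_image[of f UNIV] by simp_all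
  moreover have "lie_bracket V W \<in> generators" if VW: "V \<in> generators" "W \<in> generators" for V W
  proof -
    obtain b c \<delta> s b' c' \<delta>' s' where V: "V = f (b, c, \<delta>, s)" and W: "W = f (b', c', \<delta>', s')"
      using VW unfolding range[symmetric] by (metis imageE prod_cases4)
    \<comment> \<open>The \<open>S\<close>-term of the third component cancels since both pairs are
      multiples of \<open>(m, \<gamma>)\<close>; the bracket is a multiple of
      \<open>\<partial>\<^sub>u\<close>.\<close>
    have "lie_bracket V W = f (0, 0, (b' + s' * m) * \<delta> - (b + s * m) * \<delta>', 0)"
      unfolding V W f_def split lie_bracket_affine_field affine_field_eq_iff by (simp add: algebra_simps)
    then show ?thesis unfolding range[symmetric] by blast
  qed
  ultimately show ?thesis
    by (simp add: admits_lie_algebra_of_dim_def lie_algebra_of_vfields_def)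
qed

lemma admits_4_iff_special_form:
  "admits_lie_algebra_of_dim (pde_domain \<rho> g I) (pde \<sigma> \<rho> g) 4 \<longleftrightarrow> special_form"
proof (cases "\<exists>p0\<in>P. h p0 \<noteq> 0")
  case False
  then have h0: "\<And>p. p \<in> P \<Longrightarrow> h p = 0" by blast
  have "\<not> special_form"
  proof
    assume special_form
    from special_form_imp[OF this] h0 nonempty_P show False by auto
  qed
  then show ?thesis
    using dim_generators_if_h_zero[OF h0] by (simp add: admits_lie_algebra_of_dim_def)
next
  case True
  then obtain p0 where p0: "p0 \<in> P" "h p0 \<noteq> 0" by blast
  show ?thesis
  proof
    assume "admits_lie_algebra_of_dim (pde_domain \<rho> g I) (pde \<sigma> \<rho> g) 4"
    \<comment> \<open>Without a nonzero compatible pair the dimension would be 3.\<close>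
    then have "dim generators \<noteq> 3" by (simp add: admits_lie_algebra_of_dim_def)
    then obtain m \<gamma> where m: "compatible m \<gamma>" "(m, \<gamma>) \<noteq> (0, 0)"
      using dim_generators_if_trivial[OF p0] by auto
    then obtain C where C: "\<And>p. p \<in> P \<Longrightarrow> (m * p + \<gamma>) * h p = C"
      unfolding compatible_iff by blast
    from special_form_if[OF const_nonzero[OF p0 m(2) C] C] show special_form .
  next
    assume special_form
    from special_form_imp[OF this] obtain m \<gamma> C
      where C: "C \<noteq> 0" "\<forall>p\<in>P. (m * p + \<gamma>) * h p = C" by blast
    have "compatible m \<gamma>" unfolding compatible_iff using C(2) by blast
    moreover have "(m, \<gamma>) \<noteq> (0, 0)" using C nonempty_P by auto
    ultimately show "admits_lie_algebra_of_dim (pde_domain \<rho> g I) (pde \<sigma> \<rho> g) 4"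
      by (intro admits_4_if_compatible[OF p0])
  qed
qed

end

theorem mainTheorem2:
  fixes \<sigma> \<rho> :: real and I :: "real set" and g :: "real \<Rightarrow> real"
  assumes sigma: "\<sigma>\<^sup>2 > 0" and rho: "\<rho> > 0"
    and interval: "open I" "is_interval I" "I \<noteq> {}"
    and g_diff: "g differentiable_on I"
    and g_nz: "\<And>\<alpha>. \<alpha> \<in> I \<Longrightarrow> g \<alpha> \<noteq> 0"
    and smooth: "smooth_on (pde_domain \<rho> g I) (pde \<sigma> \<rho> g)"
  shows "admits_lie_algebra_of_dim (pde_domain \<rho> g I) (pde \<sigma> \<rho> g) 4 \<longleftrightarrow>
    (\<exists>c1 c2. c1 \<noteq> 0 \<and> c2 \<noteq> 0 \<and> (\<forall>\<alpha>\<in>I. g \<alpha> = c2 * exp (c1 * \<alpha>))) \<or>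
    (\<exists>c1 c2. c1 \<noteq> 0 \<and> c2 \<noteq> 0 \<and> (\<forall>\<alpha>\<in>I. g \<alpha> = c2 * real_power \<alpha> c1)) \<or>
    (\<exists>c1 c2 k. c1 \<noteq> 0 \<and> c2 \<noteq> 0 \<and> k \<noteq> 0 \<and>
       (\<forall>\<alpha>\<in>I. g \<alpha> = c2 * real_power (\<rho> + k * \<alpha>) (- 1 / c1)))"
proof -
  interpret feedback_pde \<sigma> \<rho> I g
    by unfold_locales (fact assms)+
  show ?thesis by (rule admits_4_iff_special_form)
qed

end
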